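(* Let $\{G_n\}_{n\ge 1}$ be a sequence of finite abelian groups with $|G_n| \to \infty$ as $n\to\infty$. 1. (Even case) If each $G_n$ has $k_n > 0$ elements of order $2$, and $\limsup_{n \to \infty} \frac{k_n}{|G_n|} < 1 - \frac{1}{2}\log_3 7$, then $$|\mathrm{MSTD}(G_n)| \sim k_n \cdot 3^{|G_n|/2}.$$ 2. (Odd case) If every $|G_n|$ is odd, and the proportion of elements in $G_n$ with order less than $\log_\varphi |G_n|$ approaches $0$ as $n \to \infty$, then $$|\mathrm{MSTD}(G_n)| \sim \tfrac{1}{2}\, |G_n|\, \varphi^{|G_n|},$$ where $\varphi = \frac{1+\sqrt5}{2}$ is the golden ratio.
   Context: For an abelian group $G$ and a subset $A\subset G$, let $A+A=\{a+b : a,b\in A\}$ and $A-A=\{a-b : a,b\in A\}$. A finite subset $A \subset G$ is an MSTD (more sums than differences) set if $|A+A| > |A-A|$. $\mathrm{MSTD}(G)$ denotes the collection of all MSTD sets $A\subset G$, and $|\mathrm{MSTD}(G)|$ the number of them. The notation $f_n \sim g_n$ means $f_n/g_n \to 1$ as $n\to\infty$. The proportion of elements of $G_n$ with a property is the number of such elements divided by $|G_n|$. *)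

theory Defs
  imports
    "HOL-Algebra.Multiplicative_Group"
    "HOL-Library.Extended_Real"
    "HOL-Library.Landau_Symbols"
begin

text \<open>
  HOL-Algebra writes groups multiplicatively, so the sumset \<open>A + A\<close> becomes the library's
  product set of \<open>A\<close> with itself, and \<open>A - A\<close> the set of all \<open>a \<otimes> inv b\<close>.
\<close>

definition sumset :: "('a, 'b) monoid_scheme \<Rightarrow> 'a set \<Rightarrow> 'a set"
  where "sumset G A = A <#>\<^bsub>G\<^esub> A"

definition diffset :: "('a, 'b) monoid_scheme \<Rightarrow> 'a set \<Rightarrow> 'a set"
  where "diffset G A = A <#>\<^bsub>G\<^esub> (set_inv\<^bsub>G\<^esub> A)"

lemma sumset_altdef: "sumset G A = {a \<otimes>\<^bsub>G\<^esub> b | a b. a \<in> A \<and> b \<in> A}"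
  by (auto simp: sumset_def set_mult_def)

lemma diffset_altdef: "diffset G A = {a \<otimes>\<^bsub>G\<^esub> inv\<^bsub>G\<^esub> b | a b. a \<in> A \<and> b \<in> A}"
  by (auto simp: diffset_def set_mult_def SET_INV_def)

definition MSTD :: "('a, 'b) monoid_scheme \<Rightarrow> 'a set set"
  where "MSTD G = {A. A \<subseteq> carrier G \<and> finite A \<and> card (sumset G A) > card (diffset G A)}"

definition num_involutions :: "('a, 'b) monoid_scheme \<Rightarrow> nat"
  where "num_involutions G = card {x \<in> carrier G. group.ord G x = 2}"

definition golden_ratio :: real
  where "golden_ratio = (1 + sqrt 5) / 2"

end

theory Submission
  imports Defs "HOL-Analysis.Convex" "HOL-Number_Theory.Fib" "HOL-Real_Asymp.Real_Asymp"
begin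

text \<open>
  A subset \<open>A\<close> of a finite abelian group of order \<open>N\<close> has more sums than differences exactly when
  it misses more elements as differences than as sums. Missing the difference \<open>d\<close> means that
  \<open>A\<close> is an independent set in the graph with edges from \<open>x\<close> to \<open>x \<otimes> d\<close>. This graph is a disjoint
  union of \<open>N / m\<close> cycles of length \<open>m\<close>, the order of \<open>d\<close>, and the cycle of length \<open>m\<close> has
  \<open>\<phi> ^ m + (- 1 / \<phi>) ^ m\<close> independent sets, a Lucas number; for \<open>m = 2\<close> this number is \<open>3\<close>. So there
  are \<open>3 powr (N / 2)\<close> sets that miss a given \<open>d\<close> of order \<open>2\<close> (lemma \<open>card_no_diff_order_two\<close>), at most
  \<open>5 powr (N / 3)\<close> that miss a given \<open>d\<close> of order at least \<open>3\<close> (\<open>card_no_diff_path\<close>), and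
  about \<open>\<phi> ^ N\<close> if the order of \<open>d\<close> is odd and large (\<open>card_no_diff_odd\<close>).

  Under the hypotheses, typically nothing else is missing. A second missing difference, apart from
  the inverse of \<open>d\<close>, or a missing sum \<open>s\<close>, which forbids that \<open>x\<close> and \<open>s \<otimes> inv x\<close> are both in \<open>A\<close>, adds edges almost
  everywhere in the graph and makes the number of independent sets exponentially smaller. Hence
  almost every set that misses a difference has all sums, so it is an MSTD set, and it misses only one
  difference and its inverse. The number of MSTD sets is therefore asymptotic to the sum over \<open>d\<close> of the
  numbers above, divided by the size of \<open>{d, inv d}\<close> (\<open>card_MSTD_le\<close>, \<open>card_MSTD_ge\<close>). In the even
  case the elements of order \<open>2\<close> dominate and are their own inverses; in the odd case almost all
  differences contribute about equally, and they come in pairs.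

  The exponential saving comes from Shearer's inequality (\<open>shearer\<close>): a family of sets is no larger
  than the product of the \<open>k\<close>-th roots of the numbers of its traces on windows that cover every point
  at least \<open>k\<close> times. The windows are the translates of a fixed small configuration, together with
  mirror images when a sum is missing (\<open>window_count\<close>), and the traces are independent sets of a graph
  with at most six vertices. Where a reflected window degenerates, the estimate fails; this happens
  at the solutions of a few equations \<open>x \<otimes> x = t\<close>. There are boundedly many in a group of odd order, and
  in general at most one more than the number of involutions for each \<open>t\<close>, which is where the
  even case uses the bound on the proportion of involutions.
\<close>

section \<open>Shearer's inequality\<close>

text \<open>
  Hoelder's inequality for \<open>card K\<close> factors, raised to the power \<open>card K\<close> so that it speaks about
  natural numbers. After division by \<open>a i + b i\<close> it is the inequality between the geometric and
  the arithmetic mean for two families of fractions that add up to \<open>1\<close> at every index.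
\<close>

lemma hoelder_prod_nat:
  fixes a b :: "'i \<Rightarrow> nat"
  assumes "finite K" "K \<noteq> {}"
    and x: "x ^ card K \<le> T * (\<Prod>i\<in>K. a i)" and y: "y ^ card K \<le> T * (\<Prod>i\<in>K. b i)"
  shows "(x + y) ^ card K \<le> T * (\<Prod>i\<in>K. a i + b i)"
proof (cases "\<exists>i\<in>K. a i + b i = 0")
  case True
  then obtain i where "i \<in> K" "a i = 0" "b i = 0" by auto
  then have "(\<Prod>i\<in>K. a i) = 0" "(\<Prod>i\<in>K. b i) = 0"
    using \<open>finite K\<close> by (auto intro: prod_zero)
  then have "x ^ card K = 0" "y ^ card K = 0" using x y by (simp_all only: mult_0_right le_zero_eq)
  then have "x = 0" "y = 0" by simp_all
  then show ?thesis using \<open>K \<noteq> {}\<close> \<open>finite K\<close> by (simp add: zero_power card_gt_0_iff)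
next
  case False
  define k where "k = card K"
  have k: "k > 0" using assms(1,2) by (simp add: k_def card_gt_0_iff)
  define t where "t i = real (a i + b i)" for i
  have t: "t i > 0" if "i \<in> K" for i using False that by (force simp: t_def)
  define R where "R = root k (real T * (\<Prod>i\<in>K. t i))"
  have R: "R \<ge> 0" unfolding R_def using t by (intro real_root_ge_zero mult_nonneg_nonneg prod_nonneg) (auto intro: less_imp_le)
  have bound: "real z \<le> R * ((\<Sum>i\<in>K. real (c i) / t i) / k)"
    if z: "z ^ card K \<le> T * (\<Prod>i\<in>K. c i)" for z c
  proof -
    have "real z ^ k \<le> real T * (\<Prod>i\<in>K. real (c i))"
      using z unfolding k_def by (metis of_nat_le_iff of_nat_mult of_nat_power of_nat_prod)
    also have "(\<Prod>i\<in>K. real (c i)) = (\<Prod>i\<in>K. t i) * (\<Prod>i\<in>K. real (c i) / t i)"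
      unfolding prod.distrib[symmetric] by (rule prod.cong) (use t in \<open>force+\<close>)
    finally have "root k (real z ^ k) \<le> root k (real T * ((\<Prod>i\<in>K. t i) * (\<Prod>i\<in>K. real (c i) / t i)))"
      using k by (simp add: real_root_le_mono)
    then have "real z \<le> R * root k (\<Prod>i\<in>K. real (c i) / t i)"
      using k by (simp add: R_def real_root_power_cancel real_root_mult mult.assoc)
    also have "root k (\<Prod>i\<in>K. real (c i) / t i) \<le> (\<Sum>i\<in>K. real (c i) / t i) / k"
      using arith_geom_mean[OF \<open>finite K\<close> \<open>K \<noteq> {}\<close>, of "\<lambda>i. real (c i) / t i"] t k
      by (simp add: k_def less_imp_le root_powr_inverse prod_nonneg sum_divide_distrib)
    finally show ?thesis using R by (simp add: mult_left_mono)
  qed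
  have "real (x + y) \<le> R * ((\<Sum>i\<in>K. real (a i) / t i + real (b i) / t i) / k)"
    using bound[OF x] bound[OF y] by (simp add: sum.distrib distrib_left add_divide_distrib)
  also have "(\<Sum>i\<in>K. real (a i) / t i + real (b i) / t i) = (\<Sum>i\<in>K. 1)"
  proof (rule sum.cong)
    fix i assume "i \<in> K"
    then show "real (a i) / t i + real (b i) / t i = 1"
      using t[of i] by (simp add: t_def add_divide_distrib[symmetric] del: of_nat_add flip: of_nat_add)
  qed simp
  finally have "real (x + y) \<le> R" using k by (simp add: k_def)
  then have "real (x + y) ^ k \<le> R ^ k" by (rule power_mono) simp
  also have "R ^ k = real T * (\<Prod>i\<in>K. t i)"
    unfolding R_def using k t by (intro real_root_pow_pos2 mult_nonneg_nonneg prod_nonneg) (auto intro: less_imp_le)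
  finally have "real ((x + y) ^ k) \<le> real (T * (\<Prod>i\<in>K. a i + b i))" by (simp add: t_def)
  then show ?thesis unfolding k_def of_nat_le_iff .
qed

text \<open>
  Shearer's inequality, by removing one point \<open>v\<close> of the ground set. The family splits into the
  members that avoid \<open>v\<close> and those that contain it. On a window through \<open>v\<close> the two parts have
  disjoint traces, whose numbers add up; on any other window neither part has more traces than the
  whole. Hoelder's inequality on \<open>k\<close> of the windows through \<open>v\<close> puts the two estimates together.
\<close>

lemma shearer:
  assumes "finite V" "F \<subseteq> Pow V" "finite I" "k > 0"
    and "\<And>v. v \<in> V \<Longrightarrow> k \<le> card {i \<in> I. v \<in> B i}"
  shows "card F ^ k \<le> (\<Prod>i\<in>I. card ((\<lambda>A. A \<inter> B i) ` F))"
  using assms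
proof (induction V arbitrary: F rule: finite_induct)
  case empty
  then consider "F = {}" | "F = {{}}" by auto
  then show ?case
  proof cases
    case 1
    then show ?thesis using \<open>k > 0\<close> by (simp add: zero_power)
  qed simp
next
  case (insert v V)
  define tr where "tr i F = card ((\<lambda>A. A \<inter> B i) ` F)" for i and F :: "'a set set"
  define F0 where "F0 = {A \<in> F. v \<notin> A}"
  define F1' where "F1' = {A \<in> F. v \<in> A}"
  define F1 where "F1 = (\<lambda>A. A - {v}) ` F1'"
  have finF: "finite F" using finite_subset[OF insert.prems(1)] insert.hyps by simp
  have fins: "finite F0" "finite F1'" using finF by (auto simp: F0_def F1'_def)
  have inj: "inj_on (\<lambda>A. A - {v}) F1'" by (auto simp: inj_on_def F1'_def)
  have "F = F0 \<union> F1'" "F0 \<inter> F1' = {}" by (auto simp: F0_def F1'_def)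
  then have cardF: "card F = card F0 + card F1"
    using fins inj by (simp add: F1_def card_image card_Un_disjoint)
  have IH0: "card F0 ^ k \<le> (\<Prod>i\<in>I. tr i F0)"
    unfolding tr_def by (rule insert.IH) (use insert.prems in \<open>auto simp: F0_def\<close>)
  have IH1: "card F1 ^ k \<le> (\<Prod>i\<in>I. tr i F1)"
    unfolding tr_def by (rule insert.IH) (use insert.prems in \<open>auto simp: F1_def F1'_def\<close>)
  have tr0: "tr i F0 \<le> tr i F" for i
    unfolding tr_def using finF by (intro card_mono) (auto simp: F0_def)
  have tr1: "tr i F1 \<le> tr i F" if "v \<notin> B i" for i
    unfolding tr_def
  proof (rule card_mono)
    have "(A - {v}) \<inter> B i = A \<inter> B i" for A using that by auto
    then show "(\<lambda>A. A \<inter> B i) ` F1 \<subseteq> (\<lambda>A. A \<inter> B i) ` F" by (auto simp: F1_def F1'_def)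
  qed (use finF in auto)
  have tr01: "tr i F0 + tr i F1 \<le> tr i F" if "v \<in> B i" for i
  proof -
    let ?X = "(\<lambda>A. A \<inter> B i) ` F0" and ?Y = "(\<lambda>A. A \<inter> B i) ` F1'"
    have "(\<lambda>A. A \<inter> B i) ` F1 = (\<lambda>A. A - {v}) ` ?Y"
      unfolding F1_def image_image by (rule image_cong) auto
    then have "tr i F1 \<le> card ?Y" unfolding tr_def using fins by (simp add: card_image_le)
    moreover have "card ?X + card ?Y = card (?X \<union> ?Y)"
      using fins that by (intro card_Un_disjoint[symmetric]) (auto simp: F0_def F1'_def)
    moreover have "?X \<union> ?Y \<subseteq> (\<lambda>A. A \<inter> B i) ` F" by (auto simp: F0_def F1'_def)
    then have "card (?X \<union> ?Y) \<le> tr i F" unfolding tr_def using finF by (intro card_mono) auto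
    ultimately show ?thesis unfolding tr_def by simp
  qed
  obtain K where K: "K \<subseteq> {i \<in> I. v \<in> B i}" "card K = k"
    using insert.prems(4)[of v] obtain_subset_with_card_n by blast
  then have finK: "finite K" "K \<subseteq> I" "K \<noteq> {}"
    using insert.prems(2) \<open>k > 0\<close> by (auto intro: finite_subset)
  define T where "T = (\<Prod>i\<in>I - K. tr i F)"
  have split: "(\<Prod>i\<in>I. f i) = (\<Prod>i\<in>I - K. f i) * (\<Prod>i\<in>K. f i)" for f :: "'b \<Rightarrow> nat"
    using finK(2) insert.prems(2) by (rule prod.subset_diff)
  have le: "(\<Prod>i\<in>I. tr i F') \<le> T * (\<Prod>i\<in>K. tr i F')"
    if "F' = F0 \<or> F' = F1" for F'
  proof -
    have "(\<Prod>i\<in>I - K. tr i F') \<le> T"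
      unfolding T_def using that tr0 tr1 tr01
      by (intro prod_mono) (metis add_leD2 zero_le)
    then show ?thesis unfolding split[of "\<lambda>i. tr i F'"] by (rule mult_right_mono) simp
  qed
  have "card F ^ k \<le> T * (\<Prod>i\<in>K. tr i F0 + tr i F1)"
    using hoelder_prod_nat[OF finK(1,3), of "card F0" T "\<lambda>i. tr i F0" "card F1" "\<lambda>i. tr i F1"]
      order_trans[OF IH0 le] order_trans[OF IH1 le] unfolding K(2) cardF by blast
  also have "\<dots> \<le> T * (\<Prod>i\<in>K. tr i F)"
    using K(1) tr01 by (intro mult_left_mono prod_mono) auto
  also have "\<dots> = (\<Prod>i\<in>I. tr i F)" unfolding T_def by (rule split[symmetric])
  finally show ?case unfolding tr_def .
qed

text \<open>
  A filtered list instead of a set of words, so that rewriting evaluates it at a concrete length.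
\<close>

definition patterns :: "(bool list \<Rightarrow> bool) \<Rightarrow> nat \<Rightarrow> nat" where
  "patterns Q k = length (filter Q (List.n_lists k [True, False]))"

text \<open>
  The form in which Shearer's inequality is applied: the window at \<open>x\<close> consists of the images of
  \<open>x\<close> under the maps in \<open>fs\<close>. Since these are permutations of \<open>V\<close>, a point \<open>v\<close> lies in the windows
  at its preimages, one for each map, and two preimages can agree only where a window has a repeated
  entry. The exceptional set \<open>E\<close> collects the base points of such windows. They are discarded; the
  points \<open>Z\<close> that they would have covered are covered by copies of the single window \<open>Z\<close>, which
  costs a factor \<open>2 ^ card Z\<close> in the size of the family.
\<close>

lemma window_count:
  fixes fs :: "('a \<Rightarrow> 'a) list"
  assumes V: "finite V" "F \<subseteq> Pow V" and fs: "fs \<noteq> []"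
    and bij: "\<And>f. f \<in> set fs \<Longrightarrow> bij_betw f V V"
    and E: "E \<subseteq> V" "\<And>x. x \<in> V - E \<Longrightarrow> distinct (map (\<lambda>f. f x) fs)"
    and Z: "finite Z" "\<And>f x. f \<in> set fs \<Longrightarrow> x \<in> E \<Longrightarrow> f x \<in> Z"
    and Q: "\<And>A x. A \<in> F \<Longrightarrow> x \<in> V - E \<Longrightarrow> Q (map (\<lambda>f. f x \<in> A) fs)"
  shows "card F ^ length fs \<le> patterns Q (length fs) ^ card (V - E) * (2 ^ card Z) ^ length fs"
proof -
  define k where "k = length fs"
  define W where "W x = set (map (\<lambda>f. f x) fs)" for x
  define I where "I = Inl ` (V - E) \<union> Inr ` {..<k}"
  define B where "B = case_sum W (\<lambda>j::nat. Z)"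
  have cover: "k \<le> card {i \<in> I. v \<in> B i}" if v: "v \<in> V" for v
  proof (cases "v \<in> Z")
    case True
    then have "Inr ` {..<k} \<subseteq> {i \<in> I. v \<in> B i}" by (auto simp: I_def B_def)
    then have "card (Inr ` {..<k} :: ('a + nat) set) \<le> card {i \<in> I. v \<in> B i}"
      using V(1) by (intro card_mono) (auto simp: I_def)
    then show ?thesis by (simp add: card_image)
  next
    case False
    \<comment> \<open>The windows through \<open>v\<close> are those at its preimages under the maps in \<open>fs\<close>.\<close>
    define g where "g j = inv_into V (fs ! j) v" for j
    have g: "g j \<in> V" "(fs ! j) (g j) = v" if "j < k" for j
    proof -
      have "v \<in> (fs ! j) ` V" using bij[of "fs ! j"] that v by (simp add: bij_betw_def k_def)
      then show "g j \<in> V" "(fs ! j) (g j) = v"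
        unfolding g_def by (auto intro: inv_into_into f_inv_into_f)
    qed
    have gE: "g j \<notin> E" if "j < k" for j
      using Z(2)[of "fs ! j" "g j"] g[OF that] that False by (auto simp: k_def)
    have inj: "inj_on g {..<k}"
    proof (rule inj_onI)
      fix i j assume ij: "i \<in> {..<k}" "j \<in> {..<k}" "g i = g j"
      then have "map (\<lambda>f. f (g i)) fs ! i = map (\<lambda>f. f (g i)) fs ! j"
        using g[of i] g[of j] by (simp add: k_def)
      moreover have "distinct (map (\<lambda>f. f (g i)) fs)"
        using ij by (intro E(2)) (simp add: g(1) gE)
      ultimately show "i = j"
        using ij nth_eq_iff_index_eq[of "map (\<lambda>f. f (g i)) fs" i j] by (simp add: k_def)
    qed
    have "v \<in> W (g j)" if "j < k" for j
      using g(2)[OF that] that unfolding W_def k_def by (auto intro!: image_eqI[of _ _ "fs ! j"])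
    then have "(Inl \<circ> g) ` {..<k} \<subseteq> {i \<in> I. v \<in> B i}"
      using g(1) gE by (auto simp: I_def B_def)
    then have "card ((Inl \<circ> g) ` {..<k} :: ('a + nat) set) \<le> card {i \<in> I. v \<in> B i}"
      using V(1) by (intro card_mono) (auto simp: I_def)
    moreover have "inj_on (Inl \<circ> g :: nat \<Rightarrow> 'a + nat) {..<k}" using inj by (simp add: comp_inj_on)
    ultimately show ?thesis by (simp only: card_image card_lessThan)
  qed
  have trW: "card ((\<lambda>A. A \<inter> W x) ` F) \<le> patterns Q k" if x: "x \<in> V - E" for x
  proof -
    let ?pat = "\<lambda>A. map (\<lambda>f. f x \<in> A) fs"
    have fin: "finite (?pat ` F)"
      using finite_subset[OF V(2)] V(1) by simp
    \<comment> \<open>The trace on the window is determined by the word of truth values along it.\<close>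
    have "(\<lambda>A. A \<inter> W x) ` F \<subseteq> (\<lambda>l. {f x | f. (f, True) \<in> set (zip fs l)}) ` ?pat ` F"
    proof (clarsimp simp: image_image)
      fix A assume "A \<in> F"
      moreover have "A \<inter> W x = {f x |f. (f, True) \<in> set (zip fs (?pat A))}"
        by (auto simp: W_def zip_map2 zip_same_conv_map image_iff)
      ultimately show "A \<inter> W x \<in> (\<lambda>A. {f x |f. (f, True) \<in> set (zip fs (?pat A))}) ` F" by blast
    qed
    then have "card ((\<lambda>A. A \<inter> W x) ` F) \<le> card (?pat ` F)"
      using fin by (meson card_image_le card_mono finite_imageI le_trans)
    also have "?pat ` F \<subseteq> set (filter Q (List.n_lists k [True, False]))"
      using Q x by (auto simp: set_n_lists k_def)
    then have "card (?pat ` F) \<le> card (set (filter Q (List.n_lists k [True, False])))"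
      by (intro card_mono) auto
    also have "\<dots> \<le> patterns Q k" unfolding patterns_def by (rule card_length)
    finally show ?thesis .
  qed
  have "(\<lambda>A. A \<inter> Z) ` F \<subseteq> Pow Z" by auto
  then have trZ: "card ((\<lambda>A. A \<inter> Z) ` F) \<le> 2 ^ card Z"
    using Z(1) card_mono[of "Pow Z"] by (simp add: card_Pow)
  have "card F ^ k \<le> (\<Prod>i\<in>I. card ((\<lambda>A. A \<inter> B i) ` F))"
    by (rule shearer) (use V fs cover in \<open>auto simp: I_def k_def\<close>)
  also have "\<dots> = (\<Prod>x\<in>V - E. card ((\<lambda>A. A \<inter> W x) ` F)) * card ((\<lambda>A. A \<inter> Z) ` F) ^ k"
    unfolding I_def using V(1)
    by (subst prod.union_disjoint) (auto simp: prod.reindex B_def)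
  also have "\<dots> \<le> patterns Q k ^ card (V - E) * (2 ^ card Z) ^ k"
    using prod_mono[of "V - E" "\<lambda>x. card ((\<lambda>A. A \<inter> W x) ` F)" "\<lambda>_. patterns Q k"] trW trZ
    by (intro mult_mono power_mono) auto
  finally show ?thesis by (simp add: k_def)
qed

section \<open>Elementary facts on numbers and sums\<close>

lemma dvd_two_nat: "n dvd (2::nat) \<Longrightarrow> n = 1 \<or> n = 2"
proof -
  assume "n dvd 2"
  then have "n \<le> 2" "n \<noteq> 0" using dvd_imp_le[of n 2] by (simp, metis dvd_0_left_iff zero_neq_numeral)
  then show ?thesis by linarith
qed

lemma le_root_power:
  fixes a c k n :: nat
  assumes "a ^ k \<le> c ^ n" "k > 0"
  shows "real a \<le> root k (real c) ^ n"
proof -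
  have "real a ^ k \<le> real c ^ n" using assms(1) by (metis of_nat_le_iff of_nat_power)
  also have "real c ^ n = (root k (real c) ^ n) ^ k"
    using assms(2) by (simp add: power_mult[symmetric] mult.commute[of n] power_mult[of _ k n])
  finally show ?thesis using assms(2) by (simp add: power_mono_iff)
qed

lemma sum_card_double_count:
  assumes "finite D" "finite U" "\<And>d. d \<in> D \<Longrightarrow> M d \<subseteq> U"
  shows "(\<Sum>d\<in>D. card (M d)) = (\<Sum>A\<in>U. card {d \<in> D. A \<in> M d})"
proof -
  have "card (M d) = card {A \<in> U. A \<in> M d}" if "d \<in> D" for d
    using assms(3)[OF that] by (intro arg_cong[of _ _ card]) blast
  then have "(\<Sum>d\<in>D. card (M d)) = (\<Sum>d\<in>D. card {A \<in> U. A \<in> M d})" by simp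
  also have "\<dots> = (\<Sum>A\<in>U. card {d \<in> D. A \<in> M d})"
    using sum.swap_restrict[OF assms(1,2), of "\<lambda>_ _. 1::nat" "\<lambda>d A. A \<in> M d"] by simp
  finally show ?thesis .
qed

lemma poly_times_geometric_tendsto_0:
  fixes q :: real
  assumes "0 < q" "q < 1"
  shows "(\<lambda>n::nat. real n ^ j * q ^ n) \<longlonglongrightarrow> 0"
  using assms by real_asymp

section \<open>Forbidden differences and sums\<close>

definition no_diff :: "('a, 'b) monoid_scheme \<Rightarrow> 'a \<Rightarrow> 'a set set"
  where "no_diff G d = {A. A \<subseteq> carrier G \<and> d \<notin> diffset G A}"

definition no_sum :: "('a, 'b) monoid_scheme \<Rightarrow> 'a \<Rightarrow> 'a set set"
  where "no_sum G s = {A. A \<subseteq> carrier G \<and> s \<notin> sumset G A}"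

lemma no_diff_subset: "no_diff G d \<subseteq> Pow (carrier G)"
  by (auto simp: no_diff_def)

text \<open>
  A word of truth values marks the members of \<open>A\<close> along a window. The predicates say that the
  marked vertices are independent in a path with three vertices, a triangle, a four-cycle with
  edges \<open>01\<close>, \<open>23\<close>, \<open>02\<close>, \<open>13\<close>, and a ladder with rails \<open>012\<close> and \<open>345\<close>.
\<close>

definition "indep_path3 l \<longleftrightarrow> \<not> (l!0 \<and> l!1) \<and> \<not> (l!1 \<and> l!2)" for l :: "bool list"
definition "indep_triangle l \<longleftrightarrow> \<not> (l!0 \<and> l!1) \<and> \<not> (l!1 \<and> l!2) \<and> \<not> (l!0 \<and> l!2)" for l :: "bool list"
definition "indep_square l \<longleftrightarrow> \<not> (l!0 \<and> l!1) \<and> \<not> (l!2 \<and> l!3) \<and> \<not> (l!0 \<and> l!2) \<and> \<not> (l!1 \<and> l!3)"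
  for l :: "bool list"
definition "indep_ladder l \<longleftrightarrow> \<not> (l!0 \<and> l!1) \<and> \<not> (l!1 \<and> l!2) \<and> \<not> (l!3 \<and> l!4) \<and> \<not> (l!4 \<and> l!5)
   \<and> \<not> (l!0 \<and> l!3) \<and> \<not> (l!1 \<and> l!4) \<and> \<not> (l!2 \<and> l!5)" for l :: "bool list"

lemma patterns_indep_path3: "patterns indep_path3 3 = 5"
  and patterns_indep_triangle: "patterns indep_triangle 3 = 4"
  and patterns_indep_square: "patterns indep_square 4 = 7"
  and patterns_indep_ladder: "patterns indep_ladder 6 = 17"
  by (simp_all add: patterns_def eval_nat_numeral indep_path3_def indep_triangle_def indep_square_def indep_ladder_def)

context comm_group
begin

lemma bij_translate: "g \<in> carrier G \<Longrightarrow> bij_betw (\<lambda>x. x \<otimes> g) (carrier G) (carrier G)"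
  by (rule bij_betw_byWitness[where f' = "\<lambda>x. x \<otimes> inv g"]) (auto simp: m_assoc)

lemma bij_reflect:
  assumes "g \<in> carrier G" "s \<in> carrier G"
  shows "bij_betw (\<lambda>x. s \<otimes> inv (x \<otimes> g)) (carrier G) (carrier G)"
proof -
  have "s \<otimes> inv (s \<otimes> inv (x \<otimes> g) \<otimes> g) = x" if "x \<in> carrier G" for x
  proof -
    have "s \<otimes> inv (x \<otimes> g) \<otimes> g = s \<otimes> inv x" using assms that by (simp add: inv_mult m_assoc)
    moreover have "s \<otimes> inv (s \<otimes> inv x) = x"
      using assms that by (simp add: inv_mult m_assoc[symmetric])
    ultimately show ?thesis by simp
  qed
  then show ?thesis
    using assms by (intro bij_betw_byWitness[where f' = "\<lambda>x. s \<otimes> inv (x \<otimes> g)"]) auto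
qed

text \<open>
  A family that is constrained in the same way on all translates of \<open>gs\<close>: all windows have
  \<open>length gs\<close> elements, so there is no exceptional set.
\<close>

lemma translate_count:
  assumes "finite (carrier G)" "F \<subseteq> Pow (carrier G)" "gs \<noteq> []" "set gs \<subseteq> carrier G" "distinct gs"
    and "\<And>A x. A \<in> F \<Longrightarrow> x \<in> carrier G \<Longrightarrow> Q (map (\<lambda>g. x \<otimes> g \<in> A) gs)"
  shows "card F ^ length gs \<le> patterns Q (length gs) ^ card (carrier G)"
proof -
  let ?fs = "map (\<lambda>g x. x \<otimes> g) gs"
  have "distinct (map (\<lambda>f. f x) ?fs)" if "x \<in> carrier G" for x
    using assms(4,5) that by (auto simp: distinct_map inj_on_def subset_iff comp_def)
  then have "card F ^ length ?fs \<le> patterns Q (length ?fs) ^ card (carrier G - {}) * (2 ^ card ({}::'a set)) ^ length ?fs"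
    using assms by (intro window_count) (auto simp: bij_translate subset_iff comp_def)
  then show ?thesis by simp
qed

text \<open>
  A family that avoids the sum \<open>s\<close> is constrained by the reflection \<open>x \<mapsto> s \<otimes> inv x\<close>, so a window
  consists of a translate of \<open>gs\<close> and its mirror image. The two halves meet exactly when a product of
  two entries of the translate is \<open>s\<close>, which is what \<open>E\<close> has to contain.
\<close>

lemma reflect_count:
  assumes "finite (carrier G)" "F \<subseteq> Pow (carrier G)" "gs \<noteq> []" "set gs \<subseteq> carrier G" "distinct gs"
    and s: "s \<in> carrier G" and E: "E \<subseteq> carrier G"
    and off: "\<And>x g h. x \<in> carrier G - E \<Longrightarrow> g \<in> set gs \<Longrightarrow> h \<in> set gs \<Longrightarrow> (x \<otimes> g) \<otimes> (x \<otimes> h) \<noteq> s"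
    and Z: "finite Z" "\<And>x g. x \<in> E \<Longrightarrow> g \<in> set gs \<Longrightarrow> x \<otimes> g \<in> Z \<and> s \<otimes> inv (x \<otimes> g) \<in> Z"
    and Q: "\<And>A x. A \<in> F \<Longrightarrow> x \<in> carrier G \<Longrightarrow>
      Q (map (\<lambda>g. x \<otimes> g \<in> A) gs @ map (\<lambda>g. s \<otimes> inv (x \<otimes> g) \<in> A) gs)"
  shows "card F ^ (2 * length gs) \<le>
    patterns Q (2 * length gs) ^ card (carrier G - E) * (2 ^ card Z) ^ (2 * length gs)"
proof -
  let ?fs = "map (\<lambda>g x. x \<otimes> g) gs @ map (\<lambda>g x. s \<otimes> inv (x \<otimes> g)) gs"
  have len: "length ?fs = 2 * length gs" by simp
  have coincide: "(x \<otimes> g) \<otimes> (x \<otimes> h) = s"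
    if "x \<otimes> g = s \<otimes> inv (x \<otimes> h)" "x \<in> carrier G" "g \<in> carrier G" "h \<in> carrier G" for x g h
    using that s by (simp add: m_assoc)
  have dist: "distinct (map (\<lambda>f. f x) ?fs)" if x: "x \<in> carrier G - E" for x
  proof -
    have "inj_on (\<lambda>g. x \<otimes> g) (set gs)" "inj_on (\<lambda>g. s \<otimes> inv (x \<otimes> g)) (set gs)"
      using assms(4) x s by (auto simp: inj_on_def subset_iff dest: inv_inj[THEN inj_onD])
    moreover have "(\<lambda>g. x \<otimes> g) ` set gs \<inter> (\<lambda>g. s \<otimes> inv (x \<otimes> g)) ` set gs = {}"
      using off[OF x] coincide x assms(4) by blast
    ultimately show ?thesis using assms(5) by (simp add: distinct_map comp_def)
  qed
  have "card F ^ length ?fs \<le> patterns Q (length ?fs) ^ card (carrier G - E) * (2 ^ card Z) ^ length ?fs"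
  proof (rule window_count[OF assms(1,2) _ _ E dist Z(1)])
    show "bij_betw f (carrier G) (carrier G)" if "f \<in> set ?fs" for f
      using that assms(4) s bij_translate bij_reflect by auto
  qed (use assms(3) Z(2) Q in \<open>auto simp: comp_def\<close>)
  then show ?thesis unfolding len .
qed

lemma no_diff_edge:
  assumes "A \<in> no_diff G d" "d \<in> carrier G" "y \<in> carrier G" "z = y \<otimes> d"
  shows "\<not> (y \<in> A \<and> z \<in> A)"
proof
  assume "y \<in> A \<and> z \<in> A"
  moreover have "z \<otimes> inv y = d" using assms by (simp add: m_ac)
  ultimately have "d \<in> diffset G A" unfolding diffset_altdef by blast
  then show False using assms(1) by (simp add: no_diff_def)
qed

lemma no_sum_edge:
  assumes "A \<in> no_sum G s" "s \<in> carrier G" "y \<in> carrier G" "z = s \<otimes> inv y"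
  shows "\<not> (y \<in> A \<and> z \<in> A)"
proof
  assume "y \<in> A \<and> z \<in> A"
  moreover have "y \<otimes> z = s" using assms by (simp add: m_ac)
  ultimately have "s \<in> sumset G A" unfolding sumset_altdef by blast
  then show False using assms(1) by (simp add: no_sum_def)
qed

lemma square_ne_one:
  assumes "d \<in> carrier G" "odd (card (carrier G))" "d \<noteq> \<one>"
  shows "d \<otimes> d \<noteq> \<one>"
proof
  assume "d \<otimes> d = \<one>"
  then have "ord d dvd 2" using assms(1) pow_eq_id[of d 2] by (simp add: numeral_2_eq_2)
  moreover have "odd (ord d)" using ord_dvd_group_order[OF assms(1)] assms(2) unfolding order_def by auto
  ultimately have "ord d = 1" using dvd_two_nat by fastforce
  then show False using assms ord_eq_1 by blast
qed

text \<open>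
  The square roots of \<open>t\<close>, if there are any, form a coset of the solutions of \<open>z \<otimes> z = \<one>\<close>, which are \<open>\<one>\<close> and the
  elements of order \<open>2\<close>.
\<close>

lemma card_square_roots_le:
  assumes fin: "finite (carrier G)" and t: "t \<in> carrier G"
  shows "card {x \<in> carrier G. x \<otimes> x = t} \<le> num_involutions G + 1"
proof (cases "\<exists>y \<in> carrier G. y \<otimes> y = t")
  case True
  then obtain y where y: "y \<in> carrier G" "y \<otimes> y = t" by blast
  let ?R = "{x \<in> carrier G. x \<otimes> x = t}"
  have "(\<lambda>x. x \<otimes> inv y) ` ?R \<subseteq> insert \<one> {x \<in> carrier G. ord x = 2}"
  proof (rule image_subsetI)
    fix x assume "x \<in> ?R"
    then have x: "x \<in> carrier G" "x \<otimes> x = t" by auto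
    let ?z = "x \<otimes> inv y"
    have z: "?z \<in> carrier G" using x y by simp
    have "?z \<otimes> ?z = (x \<otimes> x) \<otimes> inv (y \<otimes> y)" using x(1) y(1) by (simp add: inv_mult m_ac)
    then have "?z \<otimes> ?z = \<one>" using x y t by simp
    then have "ord ?z dvd 2" using z pow_eq_id[of ?z 2] by (simp add: numeral_2_eq_2)
    then have "ord ?z = 1 \<or> ord ?z = 2" by (rule dvd_two_nat)
    then show "?z \<in> insert \<one> {x \<in> carrier G. ord x = 2}" using z ord_eq_1 by blast
  qed
  moreover have "inj_on (\<lambda>x. x \<otimes> inv y) ?R" using y by (auto simp: inj_on_def)
  ultimately have "card ?R \<le> card (insert \<one> {x \<in> carrier G. ord x = 2})"
    using fin by (intro card_inj_on_le) auto
  also have "\<dots> \<le> num_involutions G + 1"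
    unfolding num_involutions_def using fin by (simp add: card_insert_if)
  finally show ?thesis .
next
  case False
  then have "{x \<in> carrier G. x \<otimes> x = t} = {}" by blast
  then show ?thesis by (simp only: card.empty)
qed

text \<open>
  Three successive points of a cycle form a path, which has five independent sets. The estimate
  suffices when elements of order \<open>2\<close> are present, as \<open>5 ^ 2 < 3 ^ 3\<close>.
\<close>

lemma card_no_diff_path:
  assumes "finite (carrier G)" "d \<in> carrier G" "d \<noteq> \<one>" "d \<otimes> d \<noteq> \<one>"
  shows "card (no_diff G d) ^ 3 \<le> 5 ^ card (carrier G)"
proof -
  let ?gs = "[\<one>, d, d \<otimes> d]"
  have len: "length ?gs = 3" by simp
  have "card (no_diff G d) ^ length ?gs \<le> patterns indep_path3 (length ?gs) ^ card (carrier G)"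
  proof (rule translate_count[OF assms(1) no_diff_subset])
    fix A x assume A: "A \<in> no_diff G d" and x: "x \<in> carrier G"
    show "indep_path3 (map (\<lambda>g. x \<otimes> g \<in> A) ?gs)"
      using no_diff_edge[OF A assms(2), of x "x \<otimes> d"]
        no_diff_edge[OF A assms(2), of "x \<otimes> d" "x \<otimes> (d \<otimes> d)"] x assms(2)
      by (simp add: indep_path3_def m_assoc)
  qed (use assms in auto)
  then show ?thesis unfolding len patterns_indep_path3 .
qed

text \<open>
  Two distinct elements of order \<open>2\<close> span a four-cycle, which has seven independent sets, and
  \<open>7 < 3 ^ 2\<close>.
\<close>

lemma card_no_diff_pair_involutions:
  assumes "finite (carrier G)" and d: "d \<in> carrier G" "d \<noteq> \<one>" "d \<otimes> d = \<one>"
    and e: "e \<in> carrier G" "e \<noteq> \<one>" "e \<otimes> e = \<one>" and "d \<noteq> e"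
  shows "card (no_diff G d \<inter> no_diff G e) ^ 4 \<le> 7 ^ card (carrier G)"
proof -
  let ?gs = "[\<one>, d, e, d \<otimes> e]"
  have len: "length ?gs = 4" by simp
  have "inv e = e" using e by (simp add: inv_equality)
  then have "d \<otimes> e \<noteq> \<one>" using d(1) e(1) \<open>d \<noteq> e\<close> by (metis inv_equality)
  then have dist: "distinct ?gs" using assms by auto
  have "card (no_diff G d \<inter> no_diff G e) ^ length ?gs
      \<le> patterns indep_square (length ?gs) ^ card (carrier G)"
  proof (rule translate_count[OF assms(1)])
    fix A x assume "A \<in> no_diff G d \<inter> no_diff G e" and x: "x \<in> carrier G"
    then have A: "A \<in> no_diff G d" "A \<in> no_diff G e" by auto
    show "indep_square (map (\<lambda>g. x \<otimes> g \<in> A) ?gs)"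
      using no_diff_edge[OF A(1) d(1), of x "x \<otimes> d"]
        no_diff_edge[OF A(1) d(1), of "x \<otimes> e" "x \<otimes> (d \<otimes> e)"]
        no_diff_edge[OF A(2) e(1), of x "x \<otimes> e"]
        no_diff_edge[OF A(2) e(1), of "x \<otimes> d" "x \<otimes> (d \<otimes> e)"] x d(1) e(1)
      by (simp add: indep_square_def m_ac)
  qed (use d(1) e(1) dist in \<open>auto simp: no_diff_def\<close>)
  then show ?thesis unfolding len patterns_indep_square .
qed

text \<open>
  In general the points \<open>\<one>, d, d\<^sup>2\<close> and their translates by \<open>e\<close> form a ladder with \<open>17\<close>
  independent sets, and \<open>17\<close> is less than the sixth power of the golden ratio. The ladder degenerates
  only if \<open>e\<close> or its inverse is \<open>d\<^sup>2\<close>; then \<open>\<one>, d, d\<^sup>2\<close> is a triangle with four independent sets,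
  and \<open>4 ^ 2 < 17\<close>.
\<close>

lemma card_no_diff_pair_odd:
  assumes fin: "finite (carrier G)" "odd (card (carrier G))"
    and d: "d \<in> carrier G" "d \<noteq> \<one>" and e: "e \<in> carrier G" "e \<noteq> \<one>"
    and ne: "e \<noteq> d" "e \<noteq> inv d"
  shows "card (no_diff G d \<inter> no_diff G e) ^ 6 \<le> 17 ^ card (carrier G)"
proof -
  have dd: "d \<otimes> d \<noteq> \<one>" using square_ne_one[OF d(1) fin(2) d(2)] .
  have de: "d \<otimes> e \<noteq> \<one>" using ne(2) d(1) e(1) by (metis inv_equality m_comm)
  have two_step: "card (no_diff G d \<inter> no_diff G e) ^ 6 \<le> 17 ^ card (carrier G)"
    if skip: "\<And>A y. A \<in> no_diff G e \<Longrightarrow> y \<in> carrier G \<Longrightarrow> \<not> (y \<in> A \<and> y \<otimes> (d \<otimes> d) \<in> A)"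
  proof -
    let ?gs = "[\<one>, d, d \<otimes> d]"
    have len: "length ?gs = 3" by simp
    have "card (no_diff G d \<inter> no_diff G e) ^ length ?gs
        \<le> patterns indep_triangle (length ?gs) ^ card (carrier G)"
    proof (rule translate_count[OF fin(1)])
      fix A x assume "A \<in> no_diff G d \<inter> no_diff G e" and x: "x \<in> carrier G"
      then have A: "A \<in> no_diff G d" "A \<in> no_diff G e" by auto
      show "indep_triangle (map (\<lambda>g. x \<otimes> g \<in> A) ?gs)"
        using no_diff_edge[OF A(1) d(1), of x "x \<otimes> d"]
          no_diff_edge[OF A(1) d(1), of "x \<otimes> d" "x \<otimes> (d \<otimes> d)"] skip[OF A(2) x] x d(1)
        by (simp add: indep_triangle_def m_assoc)
    qed (use d dd in \<open>auto simp: no_diff_def\<close>)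
    then have "card (no_diff G d \<inter> no_diff G e) ^ 3 \<le> 4 ^ card (carrier G)"
      unfolding len patterns_indep_triangle .
    then have "(card (no_diff G d \<inter> no_diff G e) ^ 3) ^ 2 \<le> (4 ^ card (carrier G)) ^ 2"
      by (rule power_mono) simp
    also have "\<dots> = 16 ^ card (carrier G)" by (simp add: power_mult[symmetric] mult.commute[of _ 2] power_mult[of 4 2])
    also have "\<dots> \<le> 17 ^ card (carrier G)" by (rule power_mono) simp_all
    finally show ?thesis by (simp add: power_mult[symmetric])
  qed
  consider (plus) "e = d \<otimes> d" | (minus) "e \<otimes> (d \<otimes> d) = \<one>" | (generic) "e \<noteq> d \<otimes> d" "e \<otimes> (d \<otimes> d) \<noteq> \<one>"
    by blast
  then show ?thesis
  proof cases
    case generic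
    let ?gs = "[\<one>, d, d \<otimes> d, e, e \<otimes> d, e \<otimes> (d \<otimes> d)]"
    have len: "length ?gs = 6" by simp
    have "e \<otimes> d \<noteq> d \<otimes> d" "e \<otimes> (d \<otimes> d) \<noteq> d \<otimes> d" "e \<otimes> d \<noteq> d" using ne(1) d e by simp_all
    moreover have "e \<otimes> (d \<otimes> d) \<noteq> d" using de d(1) e(1) by (metis m_assoc m_comm m_closed r_cancel_one')
    moreover have "e \<otimes> d \<noteq> \<one>" using de d(1) e(1) by (simp add: m_comm)
    ultimately have dist: "distinct ?gs" using d e ne dd generic by auto
    have "card (no_diff G d \<inter> no_diff G e) ^ length ?gs
        \<le> patterns indep_ladder (length ?gs) ^ card (carrier G)"
    proof (rule translate_count[OF fin(1)])
      fix A x assume "A \<in> no_diff G d \<inter> no_diff G e" and x: "x \<in> carrier G"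
      then have A: "A \<in> no_diff G d" "A \<in> no_diff G e" by auto
      note edge_d = no_diff_edge[OF A(1) d(1)] and edge_e = no_diff_edge[OF A(2) e(1)]
      show "indep_ladder (map (\<lambda>g. x \<otimes> g \<in> A) ?gs)"
        using edge_d[of x "x \<otimes> d"] edge_d[of "x \<otimes> d" "x \<otimes> (d \<otimes> d)"]
          edge_d[of "x \<otimes> e" "x \<otimes> (e \<otimes> d)"] edge_d[of "x \<otimes> (e \<otimes> d)" "x \<otimes> (e \<otimes> (d \<otimes> d))"]
          edge_e[of x "x \<otimes> e"] edge_e[of "x \<otimes> d" "x \<otimes> (e \<otimes> d)"]
          edge_e[of "x \<otimes> (d \<otimes> d)" "x \<otimes> (e \<otimes> (d \<otimes> d))"] x d(1) e(1)
        by (simp add: indep_ladder_def m_ac)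
    qed (use d(1) e(1) dist in \<open>auto simp: no_diff_def\<close>)
    then show ?thesis unfolding len patterns_indep_ladder .
  next
    case minus
    have "\<not> (y \<in> A \<and> y \<otimes> (d \<otimes> d) \<in> A)" if "A \<in> no_diff G e" "y \<in> carrier G" for A y
    proof -
      have "y \<otimes> (d \<otimes> d) \<otimes> e = y \<otimes> (e \<otimes> (d \<otimes> d))" using that(2) d(1) e(1) by (simp add: m_ac)
      then have "y = y \<otimes> (d \<otimes> d) \<otimes> e" using minus that(2) by simp
      then show ?thesis
        using no_diff_edge[OF that(1) e(1), of "y \<otimes> (d \<otimes> d)" y] that(2) d(1) by blast
    qed
    then show ?thesis by (rule two_step)
  next
    case plus
    then have "\<not> (y \<in> A \<and> y \<otimes> (d \<otimes> d) \<in> A)" if "A \<in> no_diff G e" "y \<in> carrier G" for A y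
      using no_diff_edge[OF that(1) e(1) that(2) refl] by simp
    then show ?thesis by (rule two_step)
  qed
qed

lemma num_involutions_odd:
  assumes "odd (card (carrier G))"
  shows "num_involutions G = 0"
proof -
  have "ord x \<noteq> 2" if "x \<in> carrier G" for x
    using ord_dvd_group_order[OF that] assms unfolding order_def by auto
  then have "{x \<in> carrier G. ord x = 2} = {}" by blast
  then show ?thesis unfolding num_involutions_def by (simp only: card.empty)
qed

text \<open>
  The ladder now has the points \<open>x, xd, xd\<^sup>2\<close> and their mirror images as rails. It degenerates if
  \<open>x\<^sup>2\<close> takes one of at most nine values, and square roots are unique in a group of odd order; each
  of these at most nine ladders has six points, hence the exponent \<open>54\<close>.
\<close>

lemma card_no_diff_no_sum_odd:
  assumes fin: "finite (carrier G)" "odd (card (carrier G))"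
    and d: "d \<in> carrier G" "d \<noteq> \<one>" and s: "s \<in> carrier G"
  shows "card (no_diff G d \<inter> no_sum G s) ^ 6 \<le> 17 ^ card (carrier G) * (2 ^ 54) ^ 6"
proof -
  let ?gs = "[\<one>, d, d \<otimes> d]"
  have len: "2 * length ?gs = 6" by simp
  have gs: "set ?gs \<subseteq> carrier G" using d by simp
  define E where "E = (\<Union>g\<in>set ?gs. \<Union>h\<in>set ?gs. {x \<in> carrier G. x \<otimes> x = s \<otimes> inv (g \<otimes> h)})"
  define Z where "Z = (\<Union>g\<in>set ?gs. (\<lambda>x. x \<otimes> g) ` E \<union> (\<lambda>x. s \<otimes> inv (x \<otimes> g)) ` E)"
  have finE: "finite E" "E \<subseteq> carrier G" using fin by (auto simp: E_def)
  have card_gs: "card (set ?gs) \<le> 3" using card_length[of ?gs] by simp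
  have "card E \<le> (\<Sum>g\<in>set ?gs. \<Sum>h\<in>set ?gs. 1)"
    unfolding E_def
  proof (intro order_trans[OF card_UN_le] sum_mono finite_set)
    fix g h assume "g \<in> set ?gs" "h \<in> set ?gs"
    then have "s \<otimes> inv (g \<otimes> h) \<in> carrier G" using s gs by blast
    from card_square_roots_le[OF fin(1) this]
    show "card {x \<in> carrier G. x \<otimes> x = s \<otimes> inv (g \<otimes> h)} \<le> 1"
      by (simp add: num_involutions_odd[OF fin(2)])
  qed
  also have "\<dots> \<le> 3 * 3" using mult_mono[OF card_gs card_gs] by simp
  finally have E9: "card E \<le> 9" by simp
  have "card Z \<le> (\<Sum>g\<in>set ?gs. 18)"
    unfolding Z_def
  proof (intro order_trans[OF card_UN_le] sum_mono finite_set)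
    fix g
    show "card ((\<lambda>x. x \<otimes> g) ` E \<union> (\<lambda>x. s \<otimes> inv (x \<otimes> g)) ` E) \<le> 18"
      using card_Un_le[of "(\<lambda>x. x \<otimes> g) ` E" "(\<lambda>x. s \<otimes> inv (x \<otimes> g)) ` E"] E9
        card_image_le[OF finE(1), of "\<lambda>x. x \<otimes> g"] card_image_le[OF finE(1), of "\<lambda>x. s \<otimes> inv (x \<otimes> g)"]
      by linarith
  qed
  also have "\<dots> \<le> 54" using card_gs by simp
  finally have Z54: "card Z \<le> 54" .
  have "card (no_diff G d \<inter> no_sum G s) ^ (2 * length ?gs) \<le>
      patterns indep_ladder (2 * length ?gs) ^ card (carrier G - E) * (2 ^ card Z) ^ (2 * length ?gs)"
  proof (rule reflect_count[OF fin(1) _ _ gs _ s finE(2)])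
    show "distinct ?gs" using d square_ne_one[OF d(1) fin(2) d(2)] by simp
    show "finite Z" using finE(1) by (simp add: Z_def)
    fix x g h assume x: "x \<in> carrier G - E" and gh: "g \<in> set ?gs" "h \<in> set ?gs"
    show "x \<otimes> g \<otimes> (x \<otimes> h) \<noteq> s"
    proof
      assume eq: "x \<otimes> g \<otimes> (x \<otimes> h) = s"
      have gh': "g \<in> carrier G" "h \<in> carrier G" using gh gs by blast+
      then have "s = (x \<otimes> x) \<otimes> (g \<otimes> h)" using x eq by (simp add: m_ac)
      then have "x \<otimes> x = s \<otimes> inv (g \<otimes> h)" using x gh' by (simp add: m_assoc)
      then have "x \<in> E" using x gh unfolding E_def by blast
      then show False using x by simp
    qed
  next
    fix A x assume "A \<in> no_diff G d \<inter> no_sum G s" and x: "x \<in> carrier G"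
    then have A: "A \<in> no_diff G d" "A \<in> no_sum G s" by auto
    note edge_d = no_diff_edge[OF A(1) d(1)] and edge_s = no_sum_edge[OF A(2) s]
    have "s \<otimes> inv x = s \<otimes> inv (x \<otimes> d) \<otimes> d"
      "s \<otimes> inv (x \<otimes> d) = s \<otimes> inv (x \<otimes> (d \<otimes> d)) \<otimes> d"
      using x d(1) s by (simp_all add: inv_mult m_assoc)
    then show "indep_ladder (map (\<lambda>g. x \<otimes> g \<in> A) ?gs @ map (\<lambda>g. s \<otimes> inv (x \<otimes> g) \<in> A) ?gs)"
      using edge_d[of x "x \<otimes> d"] edge_d[of "x \<otimes> d" "x \<otimes> (d \<otimes> d)"]
        edge_d[of "s \<otimes> inv (x \<otimes> d)" "s \<otimes> inv x"]
        edge_d[of "s \<otimes> inv (x \<otimes> (d \<otimes> d))" "s \<otimes> inv (x \<otimes> d)"]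
        edge_s[of x] edge_s[of "x \<otimes> d"] edge_s[of "x \<otimes> (d \<otimes> d)"] x d(1) s
      by (auto simp: indep_ladder_def m_assoc)
  qed (auto simp: Z_def no_diff_def)
  also have "\<dots> \<le> 17 ^ card (carrier G) * (2 ^ 54) ^ 6"
    unfolding len patterns_indep_ladder using Z54 fin(1)
    by (intro mult_mono power_mono power_increasing) (auto intro: card_mono)
  finally show ?thesis unfolding len .
qed

text \<open>
  The four-cycle \<open>x, xd, s inv x, s inv (xd)\<close> degenerates on the set \<open>E\<close> of square roots of \<open>s\<close> and
  \<open>s d\<close>. This set is a union of such cycles, so it can be left unconstrained at the cost of \<open>16\<close>
  instead of \<open>7\<close> for each of its points (in the fourth power of the count). By the bound on the
  number of involutions it holds at most a quarter of the group, which leaves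
  \<open>7 ^ 3 * 16 = 5488\<close> for the sixteenth power, less than \<open>3 ^ 8 = 6561\<close>.
\<close>

lemma card_no_diff_no_sum_involution:
  assumes fin: "finite (carrier G)" "8 * (num_involutions G + 1) \<le> card (carrier G)"
    and d: "d \<in> carrier G" "d \<noteq> \<one>" "d \<otimes> d = \<one>" and s: "s \<in> carrier G"
  shows "card (no_diff G d \<inter> no_sum G s) ^ 16 \<le> 5488 ^ card (carrier G)"
proof -
  let ?N = "card (carrier G)" and ?F = "no_diff G d \<inter> no_sum G s"
  let ?gs = "[\<one>, d]"
  have len: "2 * length ?gs = 4" by simp
  define E where "E = {x \<in> carrier G. x \<otimes> x = s} \<union> {x \<in> carrier G. x \<otimes> x = s \<otimes> d}"
  have finE: "finite E" "E \<subseteq> carrier G" using fin by (auto simp: E_def)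
  have "card E \<le> 2 * (num_involutions G + 1)"
    using card_Un_le[of "{x \<in> carrier G. x \<otimes> x = s}" "{x \<in> carrier G. x \<otimes> x = s \<otimes> d}"]
      card_square_roots_le[OF fin(1) s] card_square_roots_le[OF fin(1), of "s \<otimes> d"] s d(1)
    unfolding E_def by simp
  then have E4: "4 * card E \<le> ?N" using fin(2) by linarith
  have cancel_d: "y \<otimes> d \<otimes> (y \<otimes> d) = y \<otimes> y" if "y \<in> carrier G" for y
  proof -
    have "y \<otimes> d \<otimes> (y \<otimes> d) = y \<otimes> y \<otimes> (d \<otimes> d)" using that d(1) by (simp add: m_ac)
    then show ?thesis using d that by simp
  qed
  have inv_d: "inv d = d" using d by (simp add: inv_equality)
  have closed_d: "x \<otimes> d \<in> E" if "x \<in> E" for x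
    using that d(1) cancel_d[of x] by (auto simp: E_def)
  have closed_s: "s \<otimes> inv x \<in> E" if "x \<in> E" for x
  proof -
    have x: "x \<in> carrier G" using that finE(2) by blast
    have "s \<otimes> inv x \<otimes> (s \<otimes> inv x) = s \<otimes> (s \<otimes> inv (x \<otimes> x))"
      using x s by (simp add: inv_mult m_ac)
    moreover have "s \<otimes> (s \<otimes> inv s) = s" "s \<otimes> (s \<otimes> inv (s \<otimes> d)) = s \<otimes> d"
      using s d(1) inv_d by (simp_all add: inv_mult m_assoc[symmetric])
    ultimately show ?thesis using that x s unfolding E_def by auto
  qed
  have "card ?F ^ (2 * length ?gs) \<le>
      patterns indep_square (2 * length ?gs) ^ card (carrier G - E) * (2 ^ card E) ^ (2 * length ?gs)"
  proof (rule reflect_count[OF fin(1) _ _ _ _ s finE(2) _ finE(1)])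
    fix x g h assume x: "x \<in> carrier G - E" and gh: "g \<in> set ?gs" "h \<in> set ?gs"
    show "x \<otimes> g \<otimes> (x \<otimes> h) \<noteq> s"
    proof
      assume eq: "x \<otimes> g \<otimes> (x \<otimes> h) = s"
      have "x \<otimes> x = s \<or> x \<otimes> x \<otimes> d = s"
        using gh x eq cancel_d[of x] d(1) by (auto simp: m_ac)
      moreover have "x \<otimes> x = s \<otimes> d" if "x \<otimes> x \<otimes> d = s"
        using that x d by (auto simp: m_assoc)
      ultimately show False using x by (auto simp: E_def)
    qed
  next
    fix A x assume "A \<in> ?F" and x: "x \<in> carrier G"
    then have A: "A \<in> no_diff G d" "A \<in> no_sum G s" by auto
    have "s \<otimes> inv x = s \<otimes> inv (x \<otimes> d) \<otimes> d" using x d(1) s by (simp add: inv_mult m_assoc)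
    then show "indep_square (map (\<lambda>g. x \<otimes> g \<in> A) ?gs @ map (\<lambda>g. s \<otimes> inv (x \<otimes> g) \<in> A) ?gs)"
      using no_diff_edge[OF A(1) d(1), of x "x \<otimes> d"]
        no_diff_edge[OF A(1) d(1), of "s \<otimes> inv (x \<otimes> d)" "s \<otimes> inv x"]
        no_sum_edge[OF A(2) s, of x] no_sum_edge[OF A(2) s, of "x \<otimes> d"] x d(1) s
      by (auto simp: indep_square_def)
  next
    fix x g assume "x \<in> E" "g \<in> set ?gs"
    then have "x \<otimes> g \<in> E" using closed_d finE(2) by auto
    then show "x \<otimes> g \<in> E \<and> s \<otimes> inv (x \<otimes> g) \<in> E" using closed_s by blast
  qed (use d in \<open>auto simp: no_diff_def\<close>)
  then have "card ?F ^ 4 \<le> 7 ^ (?N - card E) * 16 ^ card E"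
    unfolding len patterns_indep_square card_Diff_subset[OF finE]
    by (simp add: power_mult[symmetric] mult.commute[of _ 4] power_mult[of 2 4])
  then have "(card ?F ^ 4) ^ 4 \<le> (7 ^ (?N - card E) * 16 ^ card E) ^ 4"
    by (rule power_mono) simp
  also have "\<dots> = 7 ^ (4 * (?N - card E)) * 16 ^ (4 * card E)"
    by (simp add: power_mult_distrib power_mult[symmetric] mult.commute)
  also have "4 * (?N - card E) = 3 * ?N + (?N - 4 * card E)" using E4 by simp
  also have "(7::nat) ^ (3 * ?N + (?N - 4 * card E)) * 16 ^ (4 * card E)
      \<le> 7 ^ (3 * ?N) * (16 ^ (?N - 4 * card E) * 16 ^ (4 * card E))"
    by (simp add: power_add power_mono)
  also have "\<dots> = 7 ^ (3 * ?N) * 16 ^ ?N" using E4 by (simp flip: power_add)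
  also have "\<dots> = 5488 ^ ?N" by (simp add: power_mult flip: power_mult_distrib)
  finally show ?thesis by (simp add: power_mult[symmetric])
qed

end

section \<open>Independent sets of paths and cycles\<close>

definition indep_path :: "nat \<Rightarrow> nat set set"
  where "indep_path n = {I. I \<subseteq> {..<n} \<and> (\<forall>i\<in>I. Suc i \<notin> I)}"

definition indep_cycle :: "nat \<Rightarrow> nat set set"
  where "indep_cycle m = {I. I \<subseteq> {..<m} \<and> (\<forall>i\<in>I. Suc i mod m \<notin> I)}"

lemma finite_indep_path: "finite (indep_path n)"
  by (rule finite_subset[of _ "Pow {..<n}"]) (auto simp: indep_path_def)

lemma card_indep_path: "card (indep_path n) = fib (n + 2)"
proof (induction n rule: fib.induct)
  case 1
  have "indep_path 0 = {{}}" by (auto simp: indep_path_def)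
  then show ?case by simp
next
  case 2
  have "indep_path (Suc 0) = {{}, {0}}" by (auto simp: indep_path_def)
  then show ?case by (simp add: numeral_2_eq_2)
next
  case (3 n)
  have "indep_path (Suc (Suc n)) = indep_path (Suc n) \<union> insert (Suc n) ` indep_path n"
  proof (intro equalityI subsetI)
    fix I assume I: "I \<in> indep_path (Suc (Suc n))"
    show "I \<in> indep_path (Suc n) \<union> insert (Suc n) ` indep_path n"
    proof (cases "Suc n \<in> I")
      case True
      then have "n \<notin> I" using I by (auto simp: indep_path_def)
      then have "I - {Suc n} \<in> indep_path n"
        using I by (auto simp: indep_path_def subset_iff) (metis less_antisym)
      moreover have "I = insert (Suc n) (I - {Suc n})" using True by blast
      ultimately show ?thesis by blast
    next
      case False
      have "I \<subseteq> {..<Suc n}"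
      proof
        fix i assume "i \<in> I"
        then have "i < Suc (Suc n)" "i \<noteq> Suc n" using I False by (auto simp: indep_path_def)
        then show "i \<in> {..<Suc n}" by simp
      qed
      then show ?thesis using I by (auto simp: indep_path_def)
    qed
  next
    fix I assume "I \<in> indep_path (Suc n) \<union> insert (Suc n) ` indep_path n"
    then show "I \<in> indep_path (Suc (Suc n))"
      by (auto simp: indep_path_def subset_iff less_Suc_eq)
  qed
  moreover have "indep_path (Suc n) \<inter> insert (Suc n) ` indep_path n = {}"
    by (auto simp: indep_path_def)
  moreover have "inj_on (insert (Suc n)) (indep_path n)"
  proof (rule inj_onI)
    fix I J assume "I \<in> indep_path n" "J \<in> indep_path n" "insert (Suc n) I = insert (Suc n) J"
    moreover have "Suc n \<notin> I" "Suc n \<notin> J" using calculation(1,2) by (auto simp: indep_path_def)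
    ultimately show "I = J" by (simp add: insert_ident)
  qed
  ultimately show ?case
    using 3 by (simp add: card_Un_disjoint finite_indep_path card_image)
qed

text \<open>
  The Lucas numbers: an independent set of the cycle that avoids the last vertex \<open>m - 1\<close> is one of a
  path with \<open>m - 1\<close> vertices; one that contains it avoids both neighbours, which leaves a path with
  \<open>m - 3\<close> vertices, shifted by one. For \<open>m = 2\<close> the truncated subtraction gives the empty path,
  which has the right count, and \<open>m = 1\<close> is a loop.
\<close>

lemma card_indep_cycle:
  assumes "m \<ge> 1"
  shows "card (indep_cycle m) = fib (m + 1) + fib (m - 1)"
proof (cases "m = 1")
  case True
  have "indep_cycle 1 = {{}}" by (auto simp: indep_cycle_def)
  then show ?thesis using True by simp
next
  case False
  then obtain n where m: "m = Suc (Suc n)" using assms False by (cases m; cases "m - 1") auto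
  let ?with = "(\<lambda>J. insert (Suc n) (Suc ` J)) ` indep_path (n - 1)"
  have "indep_cycle m = indep_path (Suc n) \<union> ?with"
  proof (intro equalityI subsetI)
    fix I assume I: "I \<in> indep_cycle m"
    have step: "Suc i \<notin> I" if "i \<in> I" "i < Suc n" for i
      using I that by (auto simp: indep_cycle_def m mod_less)
    show "I \<in> indep_path (Suc n) \<union> ?with"
    proof (cases "Suc n \<in> I")
      case True
      have 0: "0 \<notin> I" using I True by (auto simp: indep_cycle_def m)
      have n: "n \<notin> I" using step[of n] True by auto
      define J where "J = {j. Suc j \<in> I \<and> j < n}"
      have "J \<in> indep_path (n - 1)"
      proof -
        have "j < n - 1" if "j \<in> J" for j
          using that n by (cases n) (auto simp: J_def less_Suc_eq)
        then show ?thesis using step by (auto simp: indep_path_def J_def)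
      qed
      moreover have "I = insert (Suc n) (Suc ` J)"
      proof (intro equalityI subsetI)
        fix i assume i: "i \<in> I"
        then have "i < Suc (Suc n)" using I by (auto simp: indep_cycle_def m)
        then show "i \<in> insert (Suc n) (Suc ` J)"
          using i 0 by (cases i) (auto simp: J_def less_Suc_eq)
      qed (use True in \<open>auto simp: J_def\<close>)
      ultimately show ?thesis by blast
    next
      case False
      have "I \<subseteq> {..<Suc n}"
      proof
        fix i assume "i \<in> I"
        then have "i < Suc (Suc n)" "i \<noteq> Suc n" using I False by (auto simp: indep_cycle_def m)
        then show "i \<in> {..<Suc n}" by simp
      qed
      then have "I \<in> indep_path (Suc n)" using step by (auto simp: indep_path_def)
      then show ?thesis by blast
    qed
  next
    fix I assume "I \<in> indep_path (Suc n) \<union> ?with"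
    then show "I \<in> indep_cycle m"
    proof
      assume I: "I \<in> indep_path (Suc n)"
      have "Suc i mod m = Suc i" if "i \<in> I" for i
        using I that by (auto simp: indep_path_def m)
      then show ?thesis using I by (auto simp: indep_path_def indep_cycle_def m)
    next
      assume "I \<in> ?with"
      then obtain J where J: "J \<in> indep_path (n - 1)" "I = insert (Suc n) (Suc ` J)" by blast
      have lt: "j < n - 1" if "j \<in> J" for j using J that by (auto simp: indep_path_def)
      have "Suc (Suc j) mod m = Suc (Suc j)" if "j \<in> J" for j
        using lt[OF that] by (simp add: m)
      then show ?thesis
        using J lt by (fastforce simp: indep_path_def indep_cycle_def m)
    qed
  qed
  moreover have "indep_path (Suc n) \<inter> ?with = {}" by (auto simp: indep_path_def)
  moreover have "inj_on (\<lambda>J. insert (Suc n) (Suc ` J)) (indep_path (n - 1))"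
  proof (rule inj_onI)
    fix I J assume IJ: "I \<in> indep_path (n - 1)" "J \<in> indep_path (n - 1)"
      "insert (Suc n) (Suc ` I) = insert (Suc n) (Suc ` J)"
    have "Suc n \<notin> Suc ` I" "Suc n \<notin> Suc ` J" using IJ(1,2) by (auto simp: indep_path_def)
    then have "Suc ` I = Suc ` J" using IJ(3) by (simp add: insert_ident)
    then show "I = J" by (simp add: inj_image_eq_iff)
  qed
  ultimately have "card (indep_cycle m) = fib (Suc n + 2) + fib (n - 1 + 2)"
    by (simp only: card_Un_disjoint finite_indep_path finite_imageI card_image card_indep_path)
  also have "fib (n - 1 + 2) = fib (Suc n)" by (cases n) auto
  finally show ?thesis by (simp add: m)
qed

lemma golden_ratio_square: "golden_ratio ^ 2 = golden_ratio + 1"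
  by (simp add: golden_ratio_def power2_eq_square field_simps)

lemma golden_ratio_gt: "golden_ratio > 1"
  by (simp add: golden_ratio_def real_less_rsqrt)

lemma card_indep_cycle_golden:
  assumes "m \<ge> 1"
  shows "real (card (indep_cycle m)) = golden_ratio ^ m + (- 1 / golden_ratio) ^ m"
proof -
  define \<psi> :: real where "\<psi> = (1 - sqrt 5) / 2"
  have fib: "real (fib n) = (golden_ratio ^ n - \<psi> ^ n) / sqrt 5" for n
    using fib_closed_form[of n] by (simp add: golden_ratio_def \<psi>_def)
  obtain n where m: "m = Suc n" using assms by (cases m) auto
  have "golden_ratio * \<psi> = - 1" by (simp add: golden_ratio_def \<psi>_def field_simps)
  then have \<psi>: "- 1 / golden_ratio = \<psi>" using golden_ratio_gt by (simp add: field_simps)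
  have sq: "golden_ratio ^ 2 + 1 = golden_ratio * sqrt 5" "\<psi> ^ 2 + 1 = - (\<psi> * sqrt 5)"
    by (simp_all add: golden_ratio_def \<psi>_def power2_eq_square algebra_simps add_divide_distrib diff_divide_distrib)
  have "real (card (indep_cycle m)) =
      (golden_ratio ^ n * (golden_ratio ^ 2 + 1) - \<psi> ^ n * (\<psi> ^ 2 + 1)) / sqrt 5"
    unfolding card_indep_cycle[OF assms] of_nat_add fib by (simp add: m power2_eq_square field_simps)
  also have "\<dots> = golden_ratio ^ m + \<psi> ^ m"
    unfolding sq by (simp add: m field_simps)
  finally show ?thesis unfolding \<psi> .
qed

context comm_group
begin

section \<open>The number of sets that miss a given difference\<close>

lemma no_diff_iff:
  assumes "d \<in> carrier G"
  shows "A \<in> no_diff G d \<longleftrightarrow> A \<subseteq> carrier G \<and> (\<forall>x\<in>A. x \<otimes> d \<notin> A)"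
proof
  assume A: "A \<in> no_diff G d"
  then have "A \<subseteq> carrier G" by (simp add: no_diff_def)
  then show "A \<subseteq> carrier G \<and> (\<forall>x\<in>A. x \<otimes> d \<notin> A)"
    using no_diff_edge[OF A assms _ refl] by blast
next
  assume A: "A \<subseteq> carrier G \<and> (\<forall>x\<in>A. x \<otimes> d \<notin> A)"
  have "d \<notin> diffset G A"
  proof
    assume "d \<in> diffset G A"
    then obtain x y where xy: "d = x \<otimes> inv y" "x \<in> A" "y \<in> A" unfolding diffset_altdef by blast
    then have "x \<in> carrier G" "y \<in> carrier G" using A by blast+
    then have "y \<otimes> d = x" using xy(1) by (simp add: m_lcomm)
    then show False using A xy \<open>y \<in> carrier G\<close> by blast
  qed
  then show "A \<in> no_diff G d" using A by (simp add: no_diff_def)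
qed

text \<open>
  Multiplication by \<open>d\<close> makes every coset of the subgroup generated by \<open>d\<close> a cycle of length
  \<open>ord d\<close>.
\<close>

lemma card_coset_free:
  assumes fin: "finite (carrier G)" and d: "d \<in> carrier G" and C: "C \<in> rcosets (generate G {d})"
  shows "card {I. I \<subseteq> C \<and> (\<forall>x\<in>I. x \<otimes> d \<notin> I)} = card (indep_cycle (ord d))"
proof -
  define m where "m = ord d"
  have m: "m \<ge> 1" using ord_ge_1[OF fin d] by (simp add: m_def)
  obtain a where a: "a \<in> carrier G" "C = generate G {d} #> a" using C by (auto simp: RCOSETS_def)
  define e where "e i = d [^] i \<otimes> a" for i :: nat
  have "generate G {d} = {d [^] i | i. i \<in> {0..m - 1}}"
    using generate_pow_nat[OF d] ord_elems[OF fin d] m by (simp add: m_def)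
  also have "{0..m - 1} = {..<m}" using m by auto
  finally have C_eq: "C = e ` {..<m}" unfolding a(2) r_coset_def e_def by auto
  have "inj_on (\<lambda>i::nat. d [^] i) {0..m - 1}" unfolding m_def by (rule ord_inj[OF d])
  then have inj: "inj_on e {..<m}"
    using d a(1) \<open>{0..m - 1} = {..<m}\<close> by (auto simp: inj_on_def e_def)
  have "d [^] (Suc i mod m) = d [^] Suc i" for i
  proof -
    have "d [^] (m * (Suc i div m) + Suc i mod m) = (d [^] m) [^] (Suc i div m) \<otimes> d [^] (Suc i mod m)"
      using d by (simp only: nat_pow_mult[symmetric] nat_pow_pow nat_pow_closed)
    then show ?thesis using d by (simp add: m_def)
  qed
  then have step: "e (Suc i mod m) = e i \<otimes> d" for i
    using d a(1) by (simp add: e_def m_ac)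
  have free: "(\<forall>x\<in>e ` I. x \<otimes> d \<notin> e ` I) \<longleftrightarrow> (\<forall>i\<in>I. Suc i mod m \<notin> I)" if I: "I \<subseteq> {..<m}" for I
  proof -
    have "Suc i mod m \<in> {..<m}" for i using m by simp
    then have "e (Suc i mod m) \<in> e ` I \<longleftrightarrow> Suc i mod m \<in> I" for i
      using inj I by (meson inj_on_image_mem_iff)
    then show ?thesis by (simp add: step)
  qed
  have "{I. I \<subseteq> C \<and> (\<forall>x\<in>I. x \<otimes> d \<notin> I)} = image e ` indep_cycle m"
    unfolding C_eq indep_cycle_def using free by (auto simp: subset_image_iff)
  moreover have "inj_on (image e) (indep_cycle m)"
    by (rule inj_on_subset[OF inj_on_image_Pow[OF inj]]) (auto simp: indep_cycle_def)
  ultimately show ?thesis by (simp add: card_image m_def)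
qed

text \<open>
  The cosets can be treated independently of each other, and there are \<open>card (carrier G) div ord d\<close>
  of them.
\<close>

lemma card_no_diff:
  assumes fin: "finite (carrier G)" and d: "d \<in> carrier G"
  shows "card (no_diff G d) = card (indep_cycle (ord d)) ^ (card (carrier G) div ord d)"
proof -
  define H where "H = generate G {d}"
  have H: "subgroup H G" unfolding H_def using d by (intro generate_is_subgroup) auto
  have dH: "d \<in> H" unfolding H_def by (intro generate.incl) auto
  define \<C> where "\<C> = rcosets H"
  define free where "free C = {I. I \<subseteq> C \<and> (\<forall>x\<in>I. x \<otimes> d \<notin> I)}" for C
  have union: "\<Union>\<C> = carrier G" unfolding \<C>_def by (rule rcosets_part_G[OF H])
  have disj: "C = C'" if "C \<in> \<C>" "C' \<in> \<C>" "x \<in> C" "x \<in> C'" for C C' x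
    using rcos_disjoint[OF H] that unfolding \<C>_def pairwise_def disjnt_def by blast
  have fin\<C>: "finite \<C>" using union fin by (metis finite_UnionD)
  have closed: "x \<otimes> d \<in> C" if C: "C \<in> \<C>" "x \<in> C" for x C
  proof -
    obtain a where a: "a \<in> carrier G" "C = H #> a" using C by (auto simp: \<C>_def RCOSETS_def)
    then obtain h where h: "h \<in> H" "x = h \<otimes> a" using C by (auto simp: r_coset_def)
    then have "x \<otimes> d = (h \<otimes> d) \<otimes> a" using a d subgroup.mem_carrier[OF H] by (simp add: m_ac)
    moreover have "h \<otimes> d \<in> H" using h(1) dH by (rule subgroup.m_closed[OF H])
    ultimately show ?thesis using a by (auto simp: r_coset_def)
  qed
  have "bij_betw (\<lambda>A. \<lambda>C\<in>\<C>. A \<inter> C) (no_diff G d) (PiE \<C> free)"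
  proof (rule bij_betw_byWitness[where f' = "\<lambda>g. \<Union>C\<in>\<C>. g C"])
    show "\<forall>A\<in>no_diff G d. (\<Union>C\<in>\<C>. (\<lambda>C\<in>\<C>. A \<inter> C) C) = A"
      using union by (auto simp: no_diff_def)
    have inter: "(\<Union>C'\<in>\<C>. g C') \<inter> C = g C" if "g \<in> PiE \<C> free" "C \<in> \<C>" for g C
    proof -
      have "g C' \<subseteq> C'" if "C' \<in> \<C>" for C' using PiE_mem[OF \<open>g \<in> PiE \<C> free\<close> that] by (simp add: free_def)
      then show ?thesis using disj that(2) by blast
    qed
    then show "\<forall>g\<in>PiE \<C> free. (\<lambda>C\<in>\<C>. (\<Union>C'\<in>\<C>. g C') \<inter> C) = g"
      by (auto simp: fun_eq_iff PiE_def extensional_def)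
    show "(\<lambda>A. \<lambda>C\<in>\<C>. A \<inter> C) ` no_diff G d \<subseteq> PiE \<C> free"
      by (auto simp: no_diff_iff[OF d] free_def)
    show "(\<lambda>g. \<Union>C\<in>\<C>. g C) ` PiE \<C> free \<subseteq> no_diff G d"
    proof (rule image_subsetI)
      fix g assume g: "g \<in> PiE \<C> free"
      have sub: "g C \<subseteq> C" if "C \<in> \<C>" for C using PiE_mem[OF g that] by (simp add: free_def)
      have "x \<otimes> d \<notin> (\<Union>C\<in>\<C>. g C)" if "C \<in> \<C>" "x \<in> g C" for x C
      proof
        assume "x \<otimes> d \<in> (\<Union>C\<in>\<C>. g C)"
        moreover have "x \<otimes> d \<in> C" using closed that sub by blast
        ultimately have "x \<otimes> d \<in> g C" using inter[OF g that(1)] by blast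
        then show False using PiE_mem[OF g that(1)] that(2) by (auto simp: free_def)
      qed
      then show "(\<Union>C\<in>\<C>. g C) \<in> no_diff G d"
        unfolding no_diff_iff[OF d] using sub union by blast
    qed
  qed
  then have "card (no_diff G d) = card (PiE \<C> free)" by (rule bij_betw_same_card)
  also have "\<dots> = (\<Prod>C\<in>\<C>. card (free C))" using fin\<C> by (rule card_PiE)
  also have "\<dots> = card (indep_cycle (ord d)) ^ card \<C>"
    unfolding free_def \<C>_def H_def using card_coset_free[OF fin d] by simp
  also have "card \<C> = card (carrier G) div ord d"
  proof -
    have "card \<C> * ord d = card (carrier G)"
      using lagrange[OF H] generate_pow_card[OF d] by (simp add: \<C>_def H_def order_def)
    then show ?thesis using ord_ge_1[OF fin d] by (metis nonzero_mult_div_cancel_right not_one_le_zero)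
  qed
  finally show ?thesis .
qed

section \<open>Counting MSTD sets by missing differences\<close>

lemma no_diff_inv:
  assumes "d \<in> carrier G" "A \<in> no_diff G d"
  shows "A \<in> no_diff G (inv d)"
proof -
  have A: "A \<subseteq> carrier G" using assms(2) by (simp add: no_diff_def)
  have "x \<otimes> inv d \<notin> A" if "x \<in> A" for x
  proof
    assume "x \<otimes> inv d \<in> A"
    moreover have "x \<otimes> inv d \<otimes> d = x" using that A assms(1) by (auto simp: m_assoc)
    ultimately show False using assms that by (metis no_diff_iff)
  qed
  then show ?thesis using A assms(1) by (simp add: no_diff_iff)
qed

lemma sumset_subset: "A \<subseteq> carrier G \<Longrightarrow> sumset G A \<subseteq> carrier G"
  and diffset_subset: "A \<subseteq> carrier G \<Longrightarrow> diffset G A \<subseteq> carrier G"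
  by (auto simp: sumset_altdef diffset_altdef)

text \<open>
  The missing difference is not \<open>\<one>\<close>, because an MSTD set is nonempty.
\<close>

lemma MSTD_misses_difference:
  assumes fin: "finite (carrier G)" and A: "A \<in> MSTD G"
  obtains d where "d \<in> carrier G" "d \<noteq> \<one>" "A \<in> no_diff G d"
proof -
  have sub: "A \<subseteq> carrier G" and gt: "card (sumset G A) > card (diffset G A)"
    using A by (auto simp: MSTD_def)
  have "card (diffset G A) < card (carrier G)"
    using gt card_mono[OF fin sumset_subset[OF sub]] by linarith
  then have "diffset G A \<noteq> carrier G" by auto
  then obtain d where d: "d \<in> carrier G" "d \<notin> diffset G A"
    using diffset_subset[OF sub] by blast
  have "A \<noteq> {}" using gt by (auto simp: sumset_altdef)
  then obtain a where "a \<in> A" by blast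
  then have "a \<otimes> inv a \<in> diffset G A" unfolding diffset_altdef by blast
  then have "\<one> \<in> diffset G A" using sub \<open>a \<in> A\<close> r_inv[of a] by auto
  then show ?thesis using d sub by (intro that[of d]) (auto simp: no_diff_def)
qed

lemma MSTD_if_only_differences_missing:
  assumes fin: "finite (carrier G)" and "A \<in> no_diff G d" "d \<in> carrier G"
    and "\<And>s. s \<in> carrier G \<Longrightarrow> A \<notin> no_sum G s"
  shows "A \<in> MSTD G"
proof -
  have sub: "A \<subseteq> carrier G" using assms(2) by (simp add: no_diff_def)
  have "sumset G A = carrier G"
    using assms(4) sub sumset_subset[OF sub] by (auto simp: no_sum_def)
  moreover have "diffset G A \<subset> carrier G"
    using assms(2,3) diffset_subset[OF sub] by (auto simp: no_diff_def)
  ultimately have "card (diffset G A) < card (sumset G A)" using fin by (simp add: psubset_card_mono)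
  then show ?thesis using sub fin by (auto simp: MSTD_def intro: finite_subset)
qed

text \<open>
  Missing differences come in inverse pairs, so every MSTD set is counted at least \<open>r\<close> times
  on the right.
\<close>

lemma card_MSTD_le:
  assumes fin: "finite (carrier G)"
    and r: "\<And>d. d \<in> carrier G \<Longrightarrow> d \<noteq> \<one> \<Longrightarrow> r \<le> card {d, inv d}"
  shows "r * card (MSTD G) \<le> (\<Sum>d\<in>carrier G - {\<one>}. card (no_diff G d))"
proof -
  have "r \<le> card {d \<in> carrier G - {\<one>}. A \<in> no_diff G d}" if A: "A \<in> MSTD G" for A
  proof -
    obtain d where d: "d \<in> carrier G" "d \<noteq> \<one>" "A \<in> no_diff G d" using MSTD_misses_difference[OF fin A] .
    then have "{d, inv d} \<subseteq> {d \<in> carrier G - {\<one>}. A \<in> no_diff G d}"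
      using no_diff_inv by (auto simp: inv_eq_1_iff)
    then have "card {d, inv d} \<le> card {d \<in> carrier G - {\<one>}. A \<in> no_diff G d}"
      using fin by (intro card_mono) auto
    then show ?thesis using r[OF d(1,2)] by simp
  qed
  then have "(\<Sum>A\<in>MSTD G. r) \<le> (\<Sum>A\<in>MSTD G. card {d \<in> carrier G - {\<one>}. A \<in> no_diff G d})"
    by (rule sum_mono)
  also have "\<dots> \<le> (\<Sum>A\<in>Pow (carrier G). card {d \<in> carrier G - {\<one>}. A \<in> no_diff G d})"
    using fin by (intro sum_mono2) (auto simp: MSTD_def)
  also have "\<dots> = (\<Sum>d\<in>carrier G - {\<one>}. card (no_diff G d))"
    using fin by (intro sum_card_double_count[symmetric]) (auto simp: no_diff_def)
  finally show ?thesis by (simp add: mult.commute)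
qed

text \<open>
  Call a set bad if it misses some \<open>d \<in> D\<close> together with a sum or with some element of \<open>D\<close> other
  than \<open>d\<close> and its inverse. A set that misses an element of \<open>D\<close> and is not bad is an MSTD set, and it
  misses at most \<open>r\<close> elements of \<open>D\<close>. There are at most \<open>2 * card (carrier G) ^ 2 * b\<close> bad sets,
  and each is counted at most \<open>card (carrier G)\<close> times on the left.
\<close>

lemma card_MSTD_ge:
  assumes fin: "finite (carrier G)" and D: "D \<subseteq> carrier G" and "b \<ge> 0"
    and r: "\<And>d. d \<in> D \<Longrightarrow> card {d, inv d} \<le> r"
    and pair: "\<And>d e. d \<in> D \<Longrightarrow> e \<in> D \<Longrightarrow> e \<notin> {d, inv d} \<Longrightarrow>
      real (card (no_diff G d \<inter> no_diff G e)) \<le> b"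
    and sum: "\<And>d s. d \<in> D \<Longrightarrow> s \<in> carrier G \<Longrightarrow> real (card (no_diff G d \<inter> no_sum G s)) \<le> b"
  shows "(\<Sum>d\<in>D. real (card (no_diff G d)))
    \<le> real r * real (card (MSTD G)) + 2 * real (card (carrier G)) ^ 3 * b"
proof -
  let ?N = "card (carrier G)" and ?U = "Pow (carrier G)"
  have finD: "finite D" using D fin finite_subset by blast
  have cardD: "card D \<le> ?N" using D fin by (simp add: card_mono)
  define Bad1 where "Bad1 = (\<Union>d\<in>D. \<Union>e\<in>D - {d, inv d}. no_diff G d \<inter> no_diff G e)"
  define Bad2 where "Bad2 = (\<Union>d\<in>D. \<Union>s\<in>carrier G. no_diff G d \<inter> no_sum G s)"
  have union_le: "real (card (\<Union>i\<in>I. X i)) \<le> real ?N * c"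
    if "finite I" "card I \<le> ?N" "\<And>i. i \<in> I \<Longrightarrow> real (card (X i)) \<le> c" "c \<ge> 0"
    for I :: "'a set" and X :: "'a \<Rightarrow> 'a set set" and c
  proof -
    have "real (card (\<Union>i\<in>I. X i)) \<le> (\<Sum>i\<in>I. real (card (X i)))"
      using card_UN_le[OF that(1), of X] by (simp flip: of_nat_sum)
    also have "\<dots> \<le> (\<Sum>i\<in>I. c)" by (rule sum_mono) (rule that(3))
    also have "\<dots> \<le> real ?N * c" using that(2,4) by (simp add: mult_right_mono)
    finally show ?thesis .
  qed
  have "real (card Bad1) \<le> real ?N * (real ?N * b)"
    unfolding Bad1_def using finD cardD \<open>b \<ge> 0\<close> pair
    by (intro union_le) (auto intro: order_trans[OF card_mono])
  moreover have "real (card Bad2) \<le> real ?N * (real ?N * b)"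
    unfolding Bad2_def using finD cardD \<open>b \<ge> 0\<close> sum fin by (intro union_le) auto
  moreover have "card (Bad1 \<union> Bad2) \<le> card Bad1 + card Bad2" by (rule card_Un_le)
  ultimately have bad: "real (card (Bad1 \<union> Bad2)) \<le> 2 * real ?N ^ 2 * b"
    by (simp add: power2_eq_square)
  have point: "card {d \<in> D. A \<in> no_diff G d} \<le>
      (if A \<in> MSTD G then r else 0) + (if A \<in> Bad1 \<union> Bad2 then ?N else 0)" for A
  proof (cases "A \<in> Bad1 \<union> Bad2")
    case True
    have "card {d \<in> D. A \<in> no_diff G d} \<le> card D" using finD by (simp add: card_mono)
    then show ?thesis using True cardD by simp
  next
    case False
    show ?thesis
    proof (cases "\<exists>d\<in>D. A \<in> no_diff G d")
      case True
      then obtain d where d: "d \<in> D" "A \<in> no_diff G d" by blast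
      have "A \<in> MSTD G"
        using d D False by (intro MSTD_if_only_differences_missing[OF fin d(2)]) (auto simp: Bad2_def)
      moreover have "{e \<in> D. A \<in> no_diff G e} \<subseteq> {d, inv d}"
        using d False unfolding Bad1_def by blast
      then have "card {e \<in> D. A \<in> no_diff G e} \<le> r"
        using card_mono[of "{d, inv d}"] r[OF d(1)] by (meson finite.emptyI finite.insertI order_trans)
      ultimately show ?thesis by simp
    next
      case False
      then have "{d \<in> D. A \<in> no_diff G d} = {}" by blast
      then show ?thesis by (simp only: card.empty)
    qed
  qed
  have "(\<Sum>d\<in>D. card (no_diff G d)) = (\<Sum>A\<in>?U. card {d \<in> D. A \<in> no_diff G d})"
    using finD fin by (intro sum_card_double_count) (auto simp: no_diff_def)
  also have "\<dots> \<le> (\<Sum>A\<in>?U. (if A \<in> MSTD G then r else 0) + (if A \<in> Bad1 \<union> Bad2 then ?N else 0))"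
    by (rule sum_mono) (rule point)
  also have "\<dots> = r * card (?U \<inter> MSTD G) + ?N * card (?U \<inter> (Bad1 \<union> Bad2))"
    using fin by (simp add: sum.distrib sum.If_cases del: Un_iff)
  also have "?U \<inter> MSTD G = MSTD G" by (auto simp: MSTD_def)
  also have "?U \<inter> (Bad1 \<union> Bad2) = Bad1 \<union> Bad2" by (auto simp: Bad1_def Bad2_def no_diff_def)
  finally have "real (\<Sum>d\<in>D. card (no_diff G d)) \<le> real (r * card (MSTD G) + ?N * card (Bad1 \<union> Bad2))"
    by (simp only: of_nat_le_iff)
  also have "\<dots> \<le> real r * real (card (MSTD G)) + real ?N * (2 * real ?N ^ 2 * b)"
    using bad by (simp add: mult_left_mono)
  finally show ?thesis by (simp add: power2_eq_square power3_eq_cube mult.assoc)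
qed

section \<open>Bounds for groups with elements of order two\<close>

lemma card_no_diff_order_two:
  assumes fin: "finite (carrier G)" and d: "d \<in> carrier G" "ord d = 2"
  shows "real (card (no_diff G d)) = 3 powr (real (card (carrier G)) / 2)"
proof -
  have "even (card (carrier G))" using ord_dvd_group_order[OF d(1)] d(2) by (simp add: order_def)
  then have half: "real (card (carrier G) div 2) = real (card (carrier G)) / 2" by auto
  have "card (indep_cycle 2) = 3" by (simp add: card_indep_cycle numeral_3_eq_3)
  then have "real (card (no_diff G d)) = 3 ^ (card (carrier G) div 2)"
    using card_no_diff[OF fin d(1)] d(2) by simp
  then show ?thesis unfolding half[symmetric] by (simp add: powr_realpow)
qed

text \<open>
  The main term comes from the differences of order \<open>2\<close>; all others have order at least \<open>3\<close> and
  are covered by the path estimate.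
\<close>

lemma MSTD_even_upper:
  assumes fin: "finite (carrier G)"
  shows "real (card (MSTD G)) \<le> real (num_involutions G) * 3 powr (real (card (carrier G)) / 2)
    + real (card (carrier G)) * root 3 5 ^ card (carrier G)"
proof -
  let ?N = "card (carrier G)"
  define D where "D = {x \<in> carrier G. ord x = 2}"
  define R where "R = carrier G - {\<one>} - D"
  have sub: "D \<subseteq> carrier G - {\<one>}" "finite D" "finite R" "R \<subseteq> carrier G" using fin by (auto simp: D_def R_def)
  have small: "real (card (no_diff G d)) \<le> root 3 5 ^ ?N" if "d \<in> R" for d
  proof -
    have d: "d \<in> carrier G" "d \<noteq> \<one>" "ord d \<noteq> 2" using that by (auto simp: R_def D_def)
    have "d \<otimes> d \<noteq> \<one>"
    proof
      assume "d \<otimes> d = \<one>"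
      then have "ord d dvd 2" using d(1) pow_eq_id[of d 2] by (simp add: numeral_2_eq_2)
      then show False using dvd_two_nat d ord_eq_1 by blast
    qed
    then show ?thesis using le_root_power[OF card_no_diff_path[OF fin d(1,2)]] by simp
  qed
  have "1 * card (MSTD G) \<le> (\<Sum>d\<in>carrier G - {\<one>}. card (no_diff G d))"
    by (rule card_MSTD_le[OF fin]) (simp add: card_insert_if)
  also have "\<dots> = (\<Sum>d\<in>R. card (no_diff G d)) + (\<Sum>d\<in>D. card (no_diff G d))"
    unfolding R_def using fin sub(1) by (intro sum.subset_diff) auto
  finally have "real (card (MSTD G)) \<le> (\<Sum>d\<in>R. real (card (no_diff G d))) + (\<Sum>d\<in>D. real (card (no_diff G d)))"
    by (simp flip: of_nat_sum of_nat_add)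
  also have "(\<Sum>d\<in>R. real (card (no_diff G d))) \<le> (\<Sum>d\<in>R. root 3 5 ^ ?N)"
    by (rule sum_mono) (rule small)
  also have "\<dots> \<le> real ?N * root 3 5 ^ ?N"
    using card_mono[OF fin sub(4)] by (simp add: mult_right_mono)
  also have "(\<Sum>d\<in>D. real (card (no_diff G d))) = real (num_involutions G) * 3 powr (real ?N / 2)"
    using card_no_diff_order_two[OF fin] by (simp add: D_def num_involutions_def)
  finally show ?thesis by simp
qed

lemma MSTD_even_lower:
  assumes fin: "finite (carrier G)" and few: "8 * (num_involutions G + 1) \<le> card (carrier G)"
  shows "real (num_involutions G) * 3 powr (real (card (carrier G)) / 2) \<le> real (card (MSTD G))
    + 2 * real (card (carrier G)) ^ 3 * root 16 5488 ^ card (carrier G)"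
proof -
  let ?N = "card (carrier G)"
  define D where "D = {x \<in> carrier G. ord x = 2}"
  have D: "d \<in> carrier G" "d \<noteq> \<one>" "d \<otimes> d = \<one>" if "d \<in> D" for d
    using that pow_ord_eq_1[of d] by (auto simp: D_def numeral_2_eq_2)
  have "(\<Sum>d\<in>D. real (card (no_diff G d))) \<le> real 1 * real (card (MSTD G)) + 2 * real ?N ^ 3 * root 16 5488 ^ ?N"
  proof (rule card_MSTD_ge[OF fin])
    fix d assume d: "d \<in> D"
    then have "inv d = d" using D by (simp add: inv_equality)
    then show "card {d, inv d} \<le> 1" by simp
    fix s assume "s \<in> carrier G"
    then show "real (card (no_diff G d \<inter> no_sum G s)) \<le> root 16 5488 ^ ?N"
      using le_root_power[OF card_no_diff_no_sum_involution[OF fin few D[OF d]]] by simp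
  next
    fix d e assume d: "d \<in> D" and e: "e \<in> D" and "e \<notin> {d, inv d}"
    let ?c = "card (no_diff G d \<inter> no_diff G e)"
    have "?c ^ 4 \<le> 7 ^ ?N"
      using \<open>e \<notin> {d, inv d}\<close> by (intro card_no_diff_pair_involutions fin D[OF d] D[OF e]) auto
    then have "(?c ^ 4) ^ 4 \<le> (7 ^ ?N) ^ 4" by (rule power_mono) simp
    also have "(7 ^ ?N) ^ 4 = (2401 :: nat) ^ ?N"
      by (simp add: power_mult[symmetric] mult.commute[of ?N] power_mult[of 7 4])
    also have "\<dots> \<le> 5488 ^ ?N" by (rule power_mono) simp_all
    finally have "?c ^ 16 \<le> 5488 ^ ?N" by (simp add: power_mult[symmetric])
    then show "real ?c \<le> root 16 5488 ^ ?N" using le_root_power by fastforce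
  qed (auto simp: D_def)
  moreover have "(\<Sum>d\<in>D. real (card (no_diff G d))) = real (num_involutions G) * 3 powr (real ?N / 2)"
    using card_no_diff_order_two[OF fin] by (simp add: D_def num_involutions_def)
  ultimately show ?thesis by simp
qed

section \<open>Bounds for groups of odd order\<close>

lemma odd_ord: "odd (card (carrier G)) \<Longrightarrow> x \<in> carrier G \<Longrightarrow> odd (ord x)"
  using ord_dvd_group_order[of x] unfolding order_def by auto

text \<open>
  For odd \<open>m\<close> the Lucas number is \<open>\<phi> ^ m - 1 / \<phi> ^ m\<close>, slightly less than \<open>\<phi> ^ m\<close>; the relative
  error is compounded over the cosets.
\<close>

lemma card_no_diff_odd:
  assumes fin: "finite (carrier G)" "odd (card (carrier G))" and d: "d \<in> carrier G"
  shows "real (card (no_diff G d)) =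
    golden_ratio ^ card (carrier G) * (1 - 1 / (golden_ratio ^ ord d) ^ 2) ^ (card (carrier G) div ord d)"
proof -
  define m where "m = ord d"
  have m: "odd m" "m \<ge> 1" using odd_ord[OF fin(2) d] ord_ge_1[OF fin(1) d] by (simp_all add: m_def)
  have mN: "m * (card (carrier G) div m) = card (carrier G)"
    using ord_dvd_group_order[OF d] by (simp add: m_def order_def)
  have g: "golden_ratio ^ m \<noteq> 0" using golden_ratio_gt by simp
  have "real (card (indep_cycle m)) = golden_ratio ^ m - 1 / golden_ratio ^ m"
    using m by (simp add: card_indep_cycle_golden power_divide)
  also have "\<dots> = golden_ratio ^ m * (1 - 1 / (golden_ratio ^ m) ^ 2)"
    using g by (simp add: power2_eq_square field_simps)
  finally have "real (card (no_diff G d)) =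
      (golden_ratio ^ m * (1 - 1 / (golden_ratio ^ m) ^ 2)) ^ (card (carrier G) div m)"
    by (simp add: card_no_diff[OF fin(1) d] m_def)
  then show ?thesis by (simp add: power_mult_distrib power_mult[symmetric] mN flip: m_def)
qed

lemma card_inverse_pair:
  assumes "odd (card (carrier G))" "d \<in> carrier G" "d \<noteq> \<one>"
  shows "card {d, inv d} = 2"
proof -
  have "d \<noteq> inv d" using square_ne_one[OF assms(2,1,3)] r_inv[OF assms(2)] by metis
  then show ?thesis by simp
qed

lemma MSTD_odd_upper:
  assumes fin: "finite (carrier G)" "odd (card (carrier G))"
  shows "2 * real (card (MSTD G)) \<le> real (card (carrier G)) * golden_ratio ^ card (carrier G)"
proof -
  let ?N = "card (carrier G)"
  have small: "real (card (no_diff G d)) \<le> golden_ratio ^ ?N" if "d \<in> carrier G" for d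
  proof -
    have "(golden_ratio ^ ord d) ^ 2 \<ge> 1" using golden_ratio_gt by (simp add: one_le_power)
    then have "1 / (golden_ratio ^ ord d) ^ 2 \<le> 1" unfolding divide_le_eq_1 by linarith
    then have "(1 - 1 / (golden_ratio ^ ord d) ^ 2) ^ (?N div ord d) \<le> 1"
      by (intro power_le_one) auto
    then show ?thesis
      unfolding card_no_diff_odd[OF fin that] using golden_ratio_gt by (intro mult_left_le) auto
  qed
  have "2 * card (MSTD G) \<le> (\<Sum>d\<in>carrier G - {\<one>}. card (no_diff G d))"
    using card_inverse_pair[OF fin(2)] by (intro card_MSTD_le[OF fin(1)]) auto
  then have "2 * real (card (MSTD G)) \<le> (\<Sum>d\<in>carrier G - {\<one>}. real (card (no_diff G d)))"
    by (simp flip: of_nat_sum) 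
  also have "\<dots> \<le> (\<Sum>d\<in>carrier G. real (card (no_diff G d)))"
    using fin(1) by (intro sum_mono2) auto
  also have "\<dots> \<le> (\<Sum>d\<in>carrier G. golden_ratio ^ ?N)" by (rule sum_mono) (rule small)
  finally show ?thesis by simp
qed

text \<open>
  If \<open>d\<close> has order \<open>m \<ge> log \<phi> N\<close>, the relative error \<open>1 / \<phi> ^ (2 * m)\<close> per coset is at most
  \<open>1 / N ^ 2\<close>, and by Bernoulli's inequality at most \<open>N\<close> cosets lose a factor no smaller than
  \<open>1 - 1 / N\<close> altogether. This is what the logarithmic bound on the orders is for.
\<close>

lemma MSTD_odd_lower:
  assumes fin: "finite (carrier G)" "odd (card (carrier G))" and N: "card (carrier G) \<ge> 2"
  defines "D \<equiv> {x \<in> carrier G. \<not> real (ord x) < log golden_ratio (real (card (carrier G)))}"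
  shows "real (card D) * (golden_ratio ^ card (carrier G) * (1 - 1 / real (card (carrier G))))
    \<le> 2 * real (card (MSTD G)) + 2 * real (card (carrier G)) ^ 3 * (2 ^ 54 * root 6 17 ^ card (carrier G))"
proof -
  let ?N = "card (carrier G)"
  have large: "golden_ratio ^ ord d \<ge> real ?N" if "d \<in> D" for d
  proof -
    have "log golden_ratio (real ?N) \<le> real (ord d)" using that by (simp add: D_def)
    then have "real ?N \<le> golden_ratio powr real (ord d)"
      using golden_ratio_gt N by (simp add: log_le_iff)
    then show ?thesis using golden_ratio_gt by (simp add: powr_realpow)
  qed
  have D: "d \<in> carrier G" "d \<noteq> \<one>" if "d \<in> D" for d
  proof -
    show "d \<in> carrier G" using that by (simp add: D_def)
    have "golden_ratio < 2" by (simp add: golden_ratio_def real_less_lsqrt)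
    show "d \<noteq> \<one>"
    proof
      assume "d = \<one>"
      then have "real ?N \<le> golden_ratio" using large[OF that] by simp
      then show False using \<open>golden_ratio < 2\<close> N by linarith
    qed
  qed
  have many: "golden_ratio ^ ?N * (1 - 1 / real ?N) \<le> real (card (no_diff G d))" if d: "d \<in> D" for d
  proof -
    let ?q = "1 / (golden_ratio ^ ord d) ^ 2" and ?t = "?N div ord d"
    have "real ?N ^ 2 \<le> (golden_ratio ^ ord d) ^ 2" using large[OF d] by (rule power_mono) simp
    then have q: "?q \<le> 1 / real ?N ^ 2"
      using N golden_ratio_gt by (intro divide_left_mono) (auto intro!: mult_pos_pos)
    also have "\<dots> \<le> 1" using N by (simp add: divide_le_eq_1)
    finally have "1 + real ?t * (- ?q) \<le> (1 + - ?q) ^ ?t" by (intro Bernoulli_inequality) simp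
    moreover have "real ?t * ?q \<le> real ?N * (1 / real ?N ^ 2)"
      using q by (intro mult_mono) (auto simp: div_le_dividend)
    moreover have "real ?N * (1 / real ?N ^ 2) = 1 / real ?N" by (simp add: power2_eq_square)
    ultimately have "1 - 1 / real ?N \<le> (1 - ?q) ^ ?t" by simp
    then show ?thesis
      unfolding card_no_diff_odd[OF fin D(1)[OF d]] using golden_ratio_gt by (intro mult_left_mono) auto
  qed
  have "real (card D) * (golden_ratio ^ ?N * (1 - 1 / real ?N)) = (\<Sum>d\<in>D. golden_ratio ^ ?N * (1 - 1 / real ?N))"
    by simp
  also have "\<dots> \<le> (\<Sum>d\<in>D. real (card (no_diff G d)))" by (rule sum_mono) (rule many)
  also have "\<dots> \<le> real 2 * real (card (MSTD G)) + 2 * real ?N ^ 3 * (2 ^ 54 * root 6 17 ^ ?N)"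
  proof (rule card_MSTD_ge[OF fin(1)])
    fix d assume d: "d \<in> D"
    then show "card {d, inv d} \<le> 2" using card_inverse_pair[OF fin(2) D] by simp
    fix s assume "s \<in> carrier G"
    let ?c = "card (no_diff G d \<inter> no_sum G s)"
    have "real (?c ^ 6) \<le> real (17 ^ ?N * (2 ^ 54) ^ 6)"
      using card_no_diff_no_sum_odd[OF fin D[OF d] \<open>s \<in> carrier G\<close>] by (simp only: of_nat_le_iff)
    also have "\<dots> = (2 ^ 54 * root 6 17 ^ ?N) ^ 6"
      by (simp add: power_mult_distrib power_mult[symmetric] mult.commute[of ?N] power_mult[of _ 6 ?N])
    finally have "real ?c ^ 6 \<le> (2 ^ 54 * root 6 17 ^ ?N) ^ 6" unfolding of_nat_power .
    then show "real ?c \<le> 2 ^ 54 * root 6 17 ^ ?N"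
      by (rule power_mono_iff[THEN iffD1, rotated 3]) simp_all
  next
    fix d e assume d: "d \<in> D" and e: "e \<in> D" and ne: "e \<notin> {d, inv d}"
    have "real (card (no_diff G d \<inter> no_diff G e)) \<le> root 6 17 ^ ?N"
      using le_root_power[OF card_no_diff_pair_odd[OF fin D[OF d] D[OF e]]] ne by simp
    also have "\<dots> \<le> 2 ^ 54 * root 6 17 ^ ?N" by simp
    finally show "real (card (no_diff G d \<inter> no_diff G e)) \<le> 2 ^ 54 * root 6 17 ^ ?N" .
  qed (auto simp: D_def)
  finally show ?thesis by simp
qed

end

section \<open>The two asymptotic counts\<close>

text \<open>
  Since \<open>log 3 7 > 44 / 25\<close>, the threshold \<open>1 - 1 / 2 * log 3 7\<close> is below \<open>3 / 25 < 1 / 8\<close>, so the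
  condition of the lower bound holds from some index on. Both error terms are then a polynomial in
  the group order times a geometric sequence, relative to \<open>3 powr (N / 2)\<close>.
\<close>

theorem MSTD_asymp_even:
  fixes G :: "nat \<Rightarrow> ('a, 'b) monoid_scheme"
  assumes group: "\<And>n. n \<ge> 1 \<Longrightarrow> comm_group (G n)"
    and fin: "\<And>n. n \<ge> 1 \<Longrightarrow> finite (carrier (G n))"
    and size: "filterlim (\<lambda>n. card (carrier (G n))) at_top sequentially"
    and inv: "\<And>n. n \<ge> 1 \<Longrightarrow> num_involutions (G n) > 0"
    and few: "limsup (\<lambda>n. ereal (real (num_involutions (G n)) / real (card (carrier (G n)))))
      < ereal (1 - 1 / 2 * log 3 7)"
  shows "(\<lambda>n. real (card (MSTD (G n)))) \<sim>[sequentially]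
    (\<lambda>n. real (num_involutions (G n)) * 3 powr (real (card (carrier (G n))) / 2))"
proof (rule asymp_equivI')
  define N where "N n = card (carrier (G n))" for n
  define k where "k n = num_involutions (G n)" for n
  define q1 where "q1 = root 16 5488 / sqrt 3"
  define q2 where "q2 = root 3 5 / sqrt 3"
  have "root 16 5488 ^ 16 < sqrt 3 ^ 16"
    using power_mult[of "sqrt 3" 2 8] by simp
  then have "root 16 5488 < sqrt 3" by (rule power_less_imp_less_base) simp
  then have q1: "0 < q1" "q1 < 1" by (simp_all add: q1_def)
  have "root 3 5 ^ 6 < sqrt 3 ^ 6"
    using power_mult[of "sqrt 3" 2 3] power_mult[of "root 3 5" 3 2] by simp
  then have "root 3 5 < sqrt 3" by (rule power_less_imp_less_base) simp
  then have q2: "0 < q2" "q2 < 1" by (simp_all add: q2_def)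
  have base: "3 powr (real m / 2) = sqrt 3 ^ m" for m
    by (simp add: powr_half_sqrt[symmetric] powr_realpow[symmetric] powr_powr)
  have "real 44 < log 3 (7 ^ 25)" by (rule less_log_of_power) simp_all
  also have "\<dots> = real 25 * log 3 7" by (rule log_nat_power) simp
  finally have "1 - 1 / 2 * log 3 7 < (3 / 25)" by simp
  then have "ereal (1 - 1 / 2 * log 3 7) < ereal (3 / 25)" by simp
  from less_trans[OF few this]
  have "limsup (\<lambda>n. ereal (real (k n) / real (N n))) < ereal (3 / 25)" unfolding k_def N_def .
  then have ev_ratio: "\<forall>\<^sub>F n in sequentially. ereal (real (k n) / real (N n)) < ereal (3 / 25)"
    by (rule Limsup_lessD)
  have ev_N: "\<forall>\<^sub>F n in sequentially. N n \<ge> 200"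
    using size unfolding N_def filterlim_at_top by blast
  have bounds: "\<forall>\<^sub>F n in sequentially.
      1 - 2 * (real (N n) ^ 3 * q1 ^ N n) \<le> real (card (MSTD (G n))) / (real (k n) * 3 powr (real (N n) / 2)) \<and>
      real (card (MSTD (G n))) / (real (k n) * 3 powr (real (N n) / 2)) \<le> 1 + real (N n) ^ 1 * q2 ^ N n"
    using ev_ratio ev_N eventually_ge_at_top[of 1]
  proof eventually_elim
    case (elim n)
    interpret comm_group "G n" using group elim by blast
    define P where "P = sqrt 3 ^ N n"
    have P: "P > 0" by (simp add: P_def)
    have k: "real (k n) \<ge> 1" using inv[of n] elim by (simp add: k_def)
    then have kP: "P \<le> real (k n) * P" using P by simp
    have "real (k n) < (3 / 25) * real (N n)" using elim by (simp add: divide_less_eq)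
    moreover have "real (N n) \<ge> 200" using elim by simp
    ultimately have "real (8 * (k n + 1)) \<le> real (N n)" by simp
    then have "8 * (num_involutions (G n) + 1) \<le> card (carrier (G n))"
      unfolding k_def N_def of_nat_le_iff .
    from MSTD_even_lower[OF fin this] elim
    have "real (k n) * P \<le> real (card (MSTD (G n))) + 2 * (real (N n) ^ 3 * q1 ^ N n) * P"
      unfolding base by (simp add: P_def q1_def k_def N_def power_divide mult.assoc)
    also have "2 * (real (N n) ^ 3 * q1 ^ N n) * P \<le> 2 * (real (N n) ^ 3 * q1 ^ N n) * (real (k n) * P)"
      using kP q1(1) by (intro mult_left_mono) auto
    finally have lower: "(1 - 2 * (real (N n) ^ 3 * q1 ^ N n)) * (real (k n) * P) \<le> real (card (MSTD (G n)))"
      by (simp add: algebra_simps)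
    have "real (card (MSTD (G n))) \<le> real (k n) * P + (real (N n) ^ 1 * q2 ^ N n) * P"
      using MSTD_even_upper[OF fin] elim
      unfolding base by (simp add: P_def q2_def k_def N_def power_divide)
    also have "(real (N n) ^ 1 * q2 ^ N n) * P \<le> (real (N n) ^ 1 * q2 ^ N n) * (real (k n) * P)"
      using kP q2(1) by (intro mult_left_mono) auto
    finally have upper: "real (card (MSTD (G n))) \<le> (1 + real (N n) ^ 1 * q2 ^ N n) * (real (k n) * P)"
      by (simp add: algebra_simps)
    have "real (k n) * P > 0" using P k by simp
    then show ?case using lower upper
      unfolding base P_def[symmetric] by (simp add: pos_le_divide_eq pos_divide_le_eq)
  qed
  note bounds = bounds[unfolded eventually_conj_iff]
  have lim: "(\<lambda>n. real (N n) ^ j * q ^ N n) \<longlonglongrightarrow> 0" if "0 < q" "q < 1" for q :: real and j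
    using filterlim_compose[OF poly_times_geometric_tendsto_0[OF that, of j] size] by (simp add: N_def)
  have "(\<lambda>n. 1 - 2 * (real (N n) ^ 3 * q1 ^ N n)) \<longlonglongrightarrow> 1 - 2 * 0"
    by (intro tendsto_intros lim q1)
  then have lim_lower: "(\<lambda>n. 1 - 2 * (real (N n) ^ 3 * q1 ^ N n)) \<longlonglongrightarrow> 1" by simp
  have "(\<lambda>n. 1 + real (N n) ^ 1 * q2 ^ N n) \<longlonglongrightarrow> 1 + 0"
    by (intro tendsto_add tendsto_const lim q2)
  then have lim_upper: "(\<lambda>n. 1 + real (N n) ^ 1 * q2 ^ N n) \<longlonglongrightarrow> 1" by (simp only: add_0_right)
  show "(\<lambda>n. real (card (MSTD (G n))) /
      (real (num_involutions (G n)) * 3 powr (real (card (carrier (G n))) / 2))) \<longlonglongrightarrow> 1"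
    using tendsto_sandwich[OF conjunct1 conjunct2 lim_lower lim_upper, OF bounds bounds]
    unfolding N_def k_def .
qed

text \<open>
  The error term decays geometrically because \<open>\<phi> ^ 6 = 8 * \<phi> + 5 > 17\<close>; the orders below
  \<open>log \<phi> N\<close> cost the factor \<open>1 - p n\<close>, where \<open>p n\<close> is their proportion.
\<close>

theorem MSTD_asymp_odd:
  fixes G :: "nat \<Rightarrow> ('a, 'b) monoid_scheme"
  assumes group: "\<And>n. n \<ge> 1 \<Longrightarrow> comm_group (G n)"
    and fin: "\<And>n. n \<ge> 1 \<Longrightarrow> finite (carrier (G n))"
    and size: "filterlim (\<lambda>n. card (carrier (G n))) at_top sequentially"
    and odd: "\<And>n. n \<ge> 1 \<Longrightarrow> odd (card (carrier (G n)))"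
    and few: "(\<lambda>n. real (card {x \<in> carrier (G n).
                real (group.ord (G n) x) < log golden_ratio (real (card (carrier (G n))))})
            / real (card (carrier (G n)))) \<longlonglongrightarrow> 0"
  shows "(\<lambda>n. real (card (MSTD (G n)))) \<sim>[sequentially]
    (\<lambda>n. 1 / 2 * real (card (carrier (G n))) * golden_ratio ^ card (carrier (G n)))"
proof (rule asymp_equivI')
  define N where "N n = card (carrier (G n))" for n
  define p where "p n = real (card {x \<in> carrier (G n). real (group.ord (G n) x) < log golden_ratio (real (N n))}) / real (N n)" for n
  define q where "q = root 6 17 / golden_ratio"
  have "golden_ratio ^ 6 = 8 * golden_ratio + 5"
  proof -
    have "golden_ratio ^ 6 = (golden_ratio ^ 2) ^ 3" by (simp flip: power_mult)
    also have "\<dots> = (golden_ratio + 1) ^ 3" by (simp only: golden_ratio_square)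
    also have "\<dots> = golden_ratio * golden_ratio ^ 2 + 3 * golden_ratio ^ 2 + 3 * golden_ratio + 1"
      by (simp add: power3_eq_cube power2_eq_square algebra_simps)
    also have "\<dots> = 8 * golden_ratio + 5"
      unfolding golden_ratio_square using golden_ratio_square by (simp add: power2_eq_square algebra_simps)
    finally show ?thesis .
  qed
  moreover have "sqrt 5 > 2" by (simp add: real_less_rsqrt)
  then have "golden_ratio > 1.5" by (simp add: golden_ratio_def)
  ultimately have "root 6 17 ^ 6 < golden_ratio ^ 6" by simp
  then have "root 6 17 < golden_ratio" by (rule power_less_imp_less_base) (use golden_ratio_gt in simp)
  then have q: "0 < q" "q < 1" using golden_ratio_gt by (simp_all add: q_def)
  have ev_N: "\<forall>\<^sub>F n in sequentially. N n \<ge> 2"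
    using size unfolding N_def filterlim_at_top by blast
  have bounds: "\<forall>\<^sub>F n in sequentially.
      (1 - p n) * (1 - 1 / real (N n)) - 2 ^ 55 * (real (N n) ^ 2 * q ^ N n)
        \<le> real (card (MSTD (G n))) / (1 / 2 * real (N n) * golden_ratio ^ N n) \<and>
      real (card (MSTD (G n))) / (1 / 2 * real (N n) * golden_ratio ^ N n) \<le> 1"
    using ev_N eventually_ge_at_top[of 1]
  proof eventually_elim
    case (elim n)
    interpret comm_group "G n" using group elim by blast
    define P where "P = golden_ratio ^ N n"
    have P: "P > 0" using golden_ratio_gt by (simp add: P_def)
    have N: "real (N n) > 0" using elim by simp
    define v where "v = 1 - 1 / real (N n)"
    let ?S = "{x \<in> carrier (G n). real (ord x) < log golden_ratio (real (N n))}"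
    let ?D = "{x \<in> carrier (G n). \<not> real (ord x) < log golden_ratio (real (N n))}"
    have fin': "finite (carrier (G n))" using fin elim by blast
    have "card (?S \<union> ?D) = card ?S + card ?D" using fin' by (intro card_Un_disjoint) auto
    moreover have "?S \<union> ?D = carrier (G n)" by blast
    ultimately have "real (N n) = real (card ?S) + real (card ?D)" by (simp add: N_def)
    moreover have "p n * real (N n) = real (card ?S)" using N by (simp add: p_def)
    ultimately have D: "real (card ?D) = (1 - p n) * real (N n)" by (simp add: algebra_simps)
    have "real (card ?D) * (P * (1 - 1 / real (N n)))
        \<le> 2 * real (card (MSTD (G n))) + 2 * real (N n) ^ 3 * (2 ^ 54 * root 6 17 ^ N n)"
      using MSTD_odd_lower[OF fin'] odd[of n] elim unfolding N_def P_def by simp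
    also have "root 6 17 ^ N n = q ^ N n * P"
      using golden_ratio_gt by (simp add: q_def P_def power_divide)
    finally have "(1 - p n) * real (N n) * (P * v)
        \<le> 2 * real (card (MSTD (G n))) + 2 * real (N n) ^ 3 * (2 ^ 54 * (q ^ N n * P))"
      unfolding D v_def .
    then have "((1 - p n) * v - 2 ^ 55 * (real (N n) ^ 2 * q ^ N n)) * (real (N n) * P)
        \<le> 2 * real (card (MSTD (G n)))"
      by (simp add: algebra_simps power2_eq_square power3_eq_cube)
    moreover have "2 * real (card (MSTD (G n))) \<le> real (N n) * P"
      using MSTD_odd_upper[OF fin'] odd[of n] elim unfolding N_def P_def by simp
    moreover have "real (N n) * P > 0" using N P by simp
    moreover have "real (card (MSTD (G n))) / (1 / 2 * real (N n) * P) = 2 * real (card (MSTD (G n))) / (real (N n) * P)"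
      by (simp add: field_simps)
    ultimately show ?case unfolding P_def[symmetric] v_def[symmetric] by (simp add: pos_le_divide_eq)
  qed
  note bounds = bounds[unfolded eventually_conj_iff]
  have "(\<lambda>n. real (N n) ^ 2 * q ^ N n) \<longlonglongrightarrow> 0"
    using filterlim_compose[OF poly_times_geometric_tendsto_0[OF q, of 2] size] by (simp add: N_def)
  moreover have "(\<lambda>n. 1 / real (N n)) \<longlonglongrightarrow> 0"
    using filterlim_compose[OF lim_1_over_n size] by (simp add: N_def)
  moreover have "p \<longlonglongrightarrow> 0" using few by (simp add: p_def[abs_def] N_def)
  ultimately have "(\<lambda>n. (1 - p n) * (1 - 1 / real (N n)) - 2 ^ 55 * (real (N n) ^ 2 * q ^ N n))
      \<longlonglongrightarrow> (1 - 0) * (1 - 0) - 2 ^ 55 * 0"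
    by (intro tendsto_diff tendsto_mult tendsto_const)
  then have "(\<lambda>n. (1 - p n) * (1 - 1 / real (N n)) - 2 ^ 55 * (real (N n) ^ 2 * q ^ N n)) \<longlonglongrightarrow> 1"
    by (simp only: diff_zero mult_1 mult_zero_right)
  from tendsto_sandwich[OF conjunct1 conjunct2 this tendsto_const, OF bounds bounds]
  show "(\<lambda>n. real (card (MSTD (G n))) /
      (1 / 2 * real (card (carrier (G n))) * golden_ratio ^ card (carrier (G n)))) \<longlonglongrightarrow> 1"
    unfolding N_def .
qed

theorem theorem1p1:
  fixes G :: "nat \<Rightarrow> ('a, 'b) monoid_scheme"
  assumes "\<And>n. n \<ge> 1 \<Longrightarrow> comm_group (G n)"
    and "\<And>n. n \<ge> 1 \<Longrightarrow> finite (carrier (G n))"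
    and "filterlim (\<lambda>n. card (carrier (G n))) at_top sequentially"
  shows
    "((\<forall>n\<ge>1. num_involutions (G n) > 0) \<and>
      limsup (\<lambda>n. ereal (real (num_involutions (G n)) / real (card (carrier (G n)))))
        < ereal (1 - 1 / 2 * log 3 7)
      \<longrightarrow> (\<lambda>n. real (card (MSTD (G n)))) \<sim>[sequentially]
          (\<lambda>n. real (num_involutions (G n)) * 3 powr (real (card (carrier (G n))) / 2)))
     \<and>
     ((\<forall>n\<ge>1. odd (card (carrier (G n)))) \<and>
      (\<lambda>n. real (card {x \<in> carrier (G n).
                real (group.ord (G n) x) < log golden_ratio (real (card (carrier (G n))))})
            / real (card (carrier (G n)))) \<longlonglongrightarrow> 0
      \<longrightarrow> (\<lambda>n. real (card (MSTD (G n)))) \<sim>[sequentially]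
          (\<lambda>n. 1 / 2 * real (card (carrier (G n))) * golden_ratio ^ card (carrier (G n))))"
  using MSTD_asymp_even[OF assms] MSTD_asymp_odd[OF assms] by blast

end
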